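(* Let $(T(t))_{t\ge 0}$ be a contraction semigroup on $(X,\|\cdot\|)$ which is bi-continuous with respect to $\tau$, let $(A,D(A))$ be its $\tau$-generator, and let $\tau_m$ be the finest locally convex topology on $X$ agreeing with $\tau$ on the bounded sets of $(X,\|\cdot\|)$. Consider the following properties: (a) $(T(t))_{t\ge 0}$ is $\tau$-mean ergodic; (b) the Cesàro means $(C(r))_{r>0}$ converge in the $\tau_m$-weak operator topology as $r\to\infty$, i.e., $\langle C(r)x,\phi\rangle$ converges as $r\to\infty$ for every $\phi\in X'_{\tau_m}$ and $x\in X$; (c) for every $x\in X$ there exists an unbounded sequence $(r_n)_{n\in\mathbb{N}}\subset\mathbb{R}^+$ such that $(C(r_n)x)_{n\in\mathbb{N}}$ has a $\tau_m$-weak accumulation point in $X$; (d) for every $x\in X$ one has $\overline{\mathrm{co}\{T(t)x : t\ge0\}}^{\tau_m}\cap\mathrm{fix}\,(T(t))_{t\ge0}\neq\varnothing$; (e) the fixed space $\mathrm{fix}\,(T(t))_{t\ge0}=\ker A$ separates the dual fixed space $\mathrm{fix}\,(T(t)')_{t\ge0}=\ker A'$ in $X'_{\tau_m}$. Then (a)$\Rightarrow$(b)$\Rightarrow$(c) and (d)$\Rightarrow$(e). Moreover, if the topology $\tau$ is metrizable, then (c)$\Rightarrow$(d).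
   Context: Setting: $(X,\|\cdot\|)$ is a Banach space with norm dual $X'$, and $\tau$ is a locally convex topology on $X$ such that: (i) every $\|\cdot\|$-bounded $\tau$-Cauchy sequence converges in $(X,\tau)$; (ii) $\tau$ is coarser than the $\|\cdot\|$-topology; (iii) the topological dual $X'_\tau$ of $(X,\tau)$ is norming for $X$, i.e. $\|x\|=\sup\{|\langle x,\phi\rangle| : \phi\in X'_\tau,\ \|\phi\|_{X'}\le 1\}$ for all $x\in X$. A family $(T(t))_{t\ge0}$ of bounded linear operators on $(X,\|\cdot\|)$ is a bi-continuous semigroup with respect to $\tau$ if: $T(0)=I$ and $T(t+s)=T(t)T(s)$ for all $t,s\ge0$; there are $M\ge1$, $\omega\in\mathbb{R}$ with $\|T(t)x\|\le Me^{\omega t}\|x\|$ for all $t\ge 0$, $x\in X$; for each $x\in X$ the map $[0,\infty[\,\ni t\mapsto T(t)x\in X$ is $\tau$-continuous; and for every $\|\cdot\|$-bounded sequence $(x_n)$ which $\tau$-converges to $x$, $\tau\text{-}\lim_{n\to\infty}T(t)x_n=T(t)x$ uniformly for $t$ in bounded intervals of $[0,\infty[$. It is a contraction semigroup if $\|T(t)\|\le1$ for all $t\ge0$. The $\tau$-generator $(A,D(A))$ is defined by: $D(A)$ is the set of $x\in X$ such that $\sup_{0<t<1}\left\|\frac{T(t)x-x}{t}\right\|<\infty$ and $\tau\text{-}\lim_{t\to0^+}\frac{T(t)x-x}{t}$ exists in $X$; $Ax$ is this limit. The Cesàro means are $C(r)x=\frac1r\int_0^rT(s)x\,ds$, $r>0$,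 $x\in X$ ($\tau$-Riemann integral). The semigroup is $\tau$-mean ergodic if $C(r)x$ $\tau$-converges in $X$ as $r\to\infty$ for every $x\in X$. $\mathrm{fix}\,(T(t))_{t\ge0}=\{x\in X : T(t)x=x\ \forall t\ge0\}$. $X'_{\tau_m}$ is the topological dual of $(X,\tau_m)$, and the $\tau_m$-weak topology is $\sigma(X,X'_{\tau_m})$. $T(t)'$ is the adjoint of $T(t)$ on $X'$, and $A'$ is the adjoint of $A$. In (e), within $X'_{\tau_m}$, $\mathrm{fix}\,(T(t)')_{t\ge0}$ consists of the $x'\in X'_{\tau_m}$ with $T(t)'x'=x'$ for all $t\ge0$, and $\ker A'$ consists of the $x'\in X'_{\tau_m}$ with $\langle Ax,x'\rangle=0$ for all $x\in D(A)$. That $\mathrm{fix}\,(T(t))_{t\ge0}$ separates this dual fixed space means: for any two distinct elements $x'\neq y'$ of it there is $x\in\mathrm{fix}\,(T(t))_{t\ge0}$ with $\langle x,x'\rangle\neq\langle x,y'\rangle$. $\mathrm{co}$ is the convex hull and $\overline{\,\cdot\,}^{\tau_m}$ the $\tau_m$-closure.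
   Formalization: Scalars are real. In (b) the weak convergence is required to have a limit y in X (⟨C(r)x,φ⟩→⟨y,φ⟩ for all φ), and in (c) "unbounded" means r_n→∞; read literally, (b)⇒(c) and (c)⇒(d) fail for T(t)f(s)=f(s^{e^t}) on C[0,1] with the norm topology. *)

theory Defs
  imports "HOL-Analysis.Analysis"
begin

text \<open>
  The norm of the Banach space is the one of the type class \<open>banach\<close>; the second, locally convex
  topology is an explicit \<^typ>\<open>'a topology\<close> with carrier \<^term>\<open>UNIV\<close>.
\<close>

subsection \<open>Locally convex topologies\<close>

definition locally_convex_topology :: "'a::real_vector topology \<Rightarrow> bool" where
  "locally_convex_topology \<tau> \<longleftrightarrow>
     topspace \<tau> = UNIV \<and>
     continuous_map (prod_topology \<tau> \<tau>) \<tau> (\<lambda>(x, y). x + y) \<and>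
     continuous_map (prod_topology euclideanreal \<tau>) \<tau> (\<lambda>(c, x). c *\<^sub>R x) \<and>
     (\<forall>U. openin \<tau> U \<and> 0 \<in> U \<longrightarrow> (\<exists>V. openin \<tau> V \<and> 0 \<in> V \<and> convex V \<and> V \<subseteq> U))"

definition top_dual :: "'a::real_vector topology \<Rightarrow> ('a \<Rightarrow> real) set" where
  "top_dual \<tau> = {\<phi>. linear \<phi> \<and> continuous_map \<tau> euclideanreal \<phi>}"

text \<open>The topology \<open>\<sigma>(X, F)\<close> generated by a set of functionals.\<close>

definition weak_topology :: "('a \<Rightarrow> real) set \<Rightarrow> 'a topology" where
  "weak_topology F = topology_generated_by {\<phi> -` U | \<phi> U. \<phi> \<in> F \<and> open U}"

definition Cauchy_seq_in :: "'a::real_vector topology \<Rightarrow> (nat \<Rightarrow> 'a) \<Rightarrow> bool" where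
  "Cauchy_seq_in \<tau> x \<longleftrightarrow>
     (\<forall>U. openin \<tau> U \<and> 0 \<in> U \<longrightarrow> (\<exists>N. \<forall>m\<ge>N. \<forall>n\<ge>N. x m - x n \<in> U))"

text \<open>Cluster point of a sequence (not of its range): every neighbourhood is visited
  for infinitely many indices.\<close>

definition accumulation_point_in :: "'a topology \<Rightarrow> (nat \<Rightarrow> 'a) \<Rightarrow> 'a \<Rightarrow> bool" where
  "accumulation_point_in \<tau> x y \<longleftrightarrow>
     y \<in> topspace \<tau> \<and> (\<forall>U. openin \<tau> U \<and> y \<in> U \<longrightarrow> (\<exists>\<^sub>F n in sequentially. x n \<in> U))"

text \<open>In (iii), \<^term>\<open>onorm \<phi>\<close> is the norm of \<open>\<phi>\<close> in the norm dual: by (ii), every \<open>\<tau>\<close>-continuous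
  functional is norm-bounded. Moreover (iii) forces \<open>\<tau>\<close> to be Hausdorff.\<close>

definition bicontinuous_setting :: "'a::banach topology \<Rightarrow> bool" where
  "bicontinuous_setting \<tau> \<longleftrightarrow>
     locally_convex_topology \<tau> \<and>
     (\<forall>x. bounded (range x) \<and> Cauchy_seq_in \<tau> x \<longrightarrow> (\<exists>l. limitin \<tau> x l sequentially)) \<and>
     (\<forall>U. openin \<tau> U \<longrightarrow> open U) \<and>
     (\<forall>x. norm x = (SUP \<phi>\<in>{\<phi> \<in> top_dual \<tau>. onorm \<phi> \<le> 1}. \<bar>\<phi> x\<bar>))"

definition agrees_on_bounded :: "'a::real_normed_vector topology \<Rightarrow> 'a topology \<Rightarrow> bool" where
  "agrees_on_bounded \<rho> \<tau> \<longleftrightarrow> (\<forall>B. bounded B \<longrightarrow> subtopology \<rho> B = subtopology \<tau> B)"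

text \<open>\<open>\<tau>\<^sub>m\<close> is the finest locally convex topology that agrees with \<open>\<tau>\<close> on the norm-bounded sets.\<close>

definition is_mixed_topology :: "'a::real_normed_vector topology \<Rightarrow> 'a topology \<Rightarrow> bool" where
  "is_mixed_topology \<tau> \<tau>\<^sub>m \<longleftrightarrow>
     locally_convex_topology \<tau>\<^sub>m \<and> agrees_on_bounded \<tau>\<^sub>m \<tau> \<and>
     (\<forall>\<rho>. locally_convex_topology \<rho> \<and> agrees_on_bounded \<rho> \<tau> \<longrightarrow>
          (\<forall>U. openin \<rho> U \<longrightarrow> openin \<tau>\<^sub>m U))"

subsection \<open>Bi-continuous semigroups\<close>

text \<open>Semigroups are indexed by \<^typ>\<open>real\<close>; only the values at nonnegative times matter.\<close>

definition bicontinuous_semigroup ::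
  "'a::banach topology \<Rightarrow> (real \<Rightarrow> 'a \<Rightarrow>\<^sub>L 'a) \<Rightarrow> bool" where
  "bicontinuous_semigroup \<tau> T \<longleftrightarrow>
     T 0 = id_blinfun \<and>
     (\<forall>t\<ge>0. \<forall>s\<ge>0. T (t + s) = T t o\<^sub>L T s) \<and>
     (\<exists>M\<ge>1. \<exists>\<omega>. \<forall>t\<ge>0. \<forall>x. norm (T t x) \<le> M * exp (\<omega> * t) * norm x) \<and>
     (\<forall>x. continuous_map (top_of_set {0..}) \<tau> (\<lambda>t. T t x)) \<and>
     (\<forall>x l. bounded (range x) \<and> limitin \<tau> x l sequentially \<longrightarrow>
        (\<forall>J. is_interval J \<and> bounded J \<and> J \<subseteq> {0..} \<longrightarrow>
           (\<forall>U. openin \<tau> U \<and> 0 \<in> U \<longrightarrow>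
              (\<exists>N. \<forall>n\<ge>N. \<forall>t\<in>J. T t (x n) - T t l \<in> U))))"

definition contraction_semigroup :: "(real \<Rightarrow> 'a::real_normed_vector \<Rightarrow>\<^sub>L 'a) \<Rightarrow> bool" where
  "contraction_semigroup T \<longleftrightarrow> (\<forall>t\<ge>0. norm (T t) \<le> 1)"

definition generator_domain ::
  "'a::real_normed_vector topology \<Rightarrow> (real \<Rightarrow> 'a \<Rightarrow>\<^sub>L 'a) \<Rightarrow> 'a set" where
  "generator_domain \<tau> T =
     {x. bdd_above ((\<lambda>t. norm ((T t x - x) /\<^sub>R t)) ` {0<..<1}) \<and>
         (\<exists>y. limitin \<tau> (\<lambda>t. (T t x - x) /\<^sub>R t) y (at_right 0))}"

text \<open>Meaningful only on \<^const>\<open>generator_domain\<close>.\<close>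

definition generator ::
  "'a::real_normed_vector topology \<Rightarrow> (real \<Rightarrow> 'a \<Rightarrow>\<^sub>L 'a) \<Rightarrow> 'a \<Rightarrow> 'a" where
  "generator \<tau> T x = (THE y. limitin \<tau> (\<lambda>t. (T t x - x) /\<^sub>R t) y (at_right 0))"

definition ker_generator ::
  "'a::real_normed_vector topology \<Rightarrow> (real \<Rightarrow> 'a \<Rightarrow>\<^sub>L 'a) \<Rightarrow> 'a set" where
  "ker_generator \<tau> T = {x \<in> generator_domain \<tau> T. generator \<tau> T x = 0}"

definition fixed_space :: "(real \<Rightarrow> 'a::real_normed_vector \<Rightarrow>\<^sub>L 'a) \<Rightarrow> 'a set" where
  "fixed_space T = {x. \<forall>t\<ge>0. T t x = x}"

text \<open>The adjoint operator on functionals (\<^const>\<open>adjoint\<close> is the inner product one).\<close>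

definition dual_map :: "('a::real_normed_vector \<Rightarrow>\<^sub>L 'a) \<Rightarrow> ('a \<Rightarrow> real) \<Rightarrow> 'a \<Rightarrow> real" where
  "dual_map S \<phi> = (\<lambda>x. \<phi> (S x))"

text \<open>The dual fixed space and the kernel of \<open>A'\<close>, both taken inside a set \<open>F\<close> of functionals.\<close>

definition dual_fixed_space ::
  "('a \<Rightarrow> real) set \<Rightarrow> (real \<Rightarrow> 'a::real_normed_vector \<Rightarrow>\<^sub>L 'a) \<Rightarrow> ('a \<Rightarrow> real) set" where
  "dual_fixed_space F T = {\<phi> \<in> F. \<forall>t\<ge>0. dual_map (T t) \<phi> = \<phi>}"

definition ker_dual_generator ::
  "('a \<Rightarrow> real) set \<Rightarrow> 'a topology \<Rightarrow> (real \<Rightarrow> 'a::real_normed_vector \<Rightarrow>\<^sub>L 'a) \<Rightarrow> ('a \<Rightarrow> real) set"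
  where
  "ker_dual_generator F \<tau> T = {\<phi> \<in> F. \<forall>x\<in>generator_domain \<tau> T. \<phi> (generator \<tau> T x) = 0}"

definition separates :: "'a set \<Rightarrow> ('a \<Rightarrow> real) set \<Rightarrow> bool" where
  "separates S F \<longleftrightarrow> (\<forall>\<phi>\<in>F. \<forall>\<psi>\<in>F. \<phi> \<noteq> \<psi> \<longrightarrow> (\<exists>x\<in>S. \<phi> x \<noteq> \<psi> x))"

subsection \<open>Riemann integral and Cesaro means\<close>

text \<open>The \<open>\<tau>\<close>-Riemann integral is the \<open>\<tau>\<close>-limit of the Riemann sums as the mesh
  of the tagged partition tends to \<open>0\<close>.\<close>

definition has_riemann_integral ::
  "'a::real_vector topology \<Rightarrow> (real \<Rightarrow> 'a) \<Rightarrow> real \<Rightarrow> real \<Rightarrow> 'a \<Rightarrow> bool" where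
  "has_riemann_integral \<tau> f a b y \<longleftrightarrow>
     y \<in> topspace \<tau> \<and>
     (\<forall>U. openin \<tau> U \<and> y \<in> U \<longrightarrow>
        (\<exists>\<delta>>0. \<forall>p. p tagged_division_of {a..b} \<and> (\<forall>(s, K)\<in>p. diameter K < \<delta>) \<longrightarrow>
           (\<Sum>(s, K)\<in>p. measure lborel K *\<^sub>R f s) \<in> U))"

definition riemann_integral ::
  "'a::real_vector topology \<Rightarrow> (real \<Rightarrow> 'a) \<Rightarrow> real \<Rightarrow> real \<Rightarrow> 'a" where
  "riemann_integral \<tau> f a b = (THE y. has_riemann_integral \<tau> f a b y)"

definition cesaro_mean ::
  "'a::real_normed_vector topology \<Rightarrow> (real \<Rightarrow> 'a \<Rightarrow>\<^sub>L 'a) \<Rightarrow> real \<Rightarrow> 'a \<Rightarrow> 'a" where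
  "cesaro_mean \<tau> T r x = (1 / r) *\<^sub>R riemann_integral \<tau> (\<lambda>s. T s x) 0 r"

definition mean_ergodic ::
  "'a::real_normed_vector topology \<Rightarrow> (real \<Rightarrow> 'a \<Rightarrow>\<^sub>L 'a) \<Rightarrow> bool" where
  "mean_ergodic \<tau> T \<longleftrightarrow> (\<forall>x. \<exists>y. limitin \<tau> (\<lambda>r. cesaro_mean \<tau> T r x) y at_top)"

text \<open>Convergence in the weak operator topology asks for a limit in the space: for each \<open>x\<close>
  there is \<open>y\<close> with \<open>\<phi> (C(r) x) \<rightarrow> \<phi> y\<close> for all \<open>\<phi>\<close>. Mere convergence of all the
  scalar families would not yield a weak accumulation point: for \<open>(T(t) f)(s) = f (s powr exp t)\<close>
  on \<open>C[0,1]\<close> with \<open>\<tau>\<close> the norm topology they all converge, but in general without weak limit.\<close>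

definition cesaro_weakly_convergent ::
  "'a::real_normed_vector topology \<Rightarrow> 'a topology \<Rightarrow> (real \<Rightarrow> 'a \<Rightarrow>\<^sub>L 'a) \<Rightarrow> bool" where
  "cesaro_weakly_convergent \<tau> \<tau>\<^sub>m T \<longleftrightarrow>
     (\<forall>x. \<exists>y. \<forall>\<phi>\<in>top_dual \<tau>\<^sub>m. ((\<lambda>r. \<phi> (cesaro_mean \<tau> T r x)) \<longlongrightarrow> \<phi> y) at_top)"

text \<open>The times \<open>r n\<close> tend to infinity. Being merely unbounded would make the property
  trivial: in the sequence 1, 1, 1, 2, 1, 3, ... the value at time 1 recurs.\<close>

definition cesaro_weakly_accumulating ::
  "'a::real_normed_vector topology \<Rightarrow> 'a topology \<Rightarrow> (real \<Rightarrow> 'a \<Rightarrow>\<^sub>L 'a) \<Rightarrow> bool" where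
  "cesaro_weakly_accumulating \<tau> \<tau>\<^sub>m T \<longleftrightarrow>
     (\<forall>x. \<exists>r. (\<forall>n. r n > 0) \<and> filterlim r at_top sequentially \<and>
        (\<exists>y. accumulation_point_in (weak_topology (top_dual \<tau>\<^sub>m))
               (\<lambda>n. cesaro_mean \<tau> T (r n) x) y))"

definition orbit_hulls_meet_fixed_space ::
  "'a::real_normed_vector topology \<Rightarrow> (real \<Rightarrow> 'a \<Rightarrow>\<^sub>L 'a) \<Rightarrow> bool" where
  "orbit_hulls_meet_fixed_space \<tau>\<^sub>m T \<longleftrightarrow>
     (\<forall>x. (\<tau>\<^sub>m closure_of (convex hull ((\<lambda>t. T t x) ` {0..}))) \<inter> fixed_space T \<noteq> {})"

end

theory Submission
  imports Defs
begin

text \<open>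
  Everything is tested against continuous functionals: by Hahn--Banach, a point lies in a convex
  open neighbourhood of \<open>0\<close> as soon as every functional that is at most \<open>1\<close> there is smaller than
  \<open>1\<close> at the point. This gives the existence of the \<open>\<tau>\<close>-Riemann integrals \<open>J t x\<close> of the orbits,
  and the identity \<open>T h (J t x) - J t x = T t (J h x) - J h x\<close> between them. Dividing by \<open>h\<close> and
  letting \<open>h \<rightarrow> 0\<close> shows that \<open>J t x\<close> lies in the domain of the generator, which sends it to
  \<open>T t x - x\<close>; hence the description of the dual fixed space. Dividing by \<open>t\<close> and letting
  \<open>t \<rightarrow> \<infinity>\<close> makes the weak accumulation points of the Cesaro means fixed, once \<open>\<phi> \<circ> T h\<close> is known
  to be \<open>\<tau>\<^sub>m\<close>-continuous. This is where metrizability enters: \<open>\<phi> \<circ> T h\<close> is sequentially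
  \<open>\<tau>\<close>-continuous on bounded sets, hence \<open>\<tau>\<close>-continuous there. Accumulation points lie in the closed
  convex hull of the orbit by separation. An \<open>x\<close> in the kernel of the generator is fixed because
  \<open>T t x - x\<close> is the sum of the \<open>k\<close> increments \<open>T (j h) (T h x - x)\<close>, \<open>h = t / k\<close>, which are
  uniformly \<open>o(h)\<close>.
\<close>

subsection \<open>The Hahn--Banach theorem\<close>

definition sublinear :: "('a::real_vector \<Rightarrow> real) \<Rightarrow> bool" where
  "sublinear p \<longleftrightarrow> (\<forall>x y. p (x + y) \<le> p x + p y) \<and> (\<forall>c x. 0 \<le> c \<longrightarrow> p (c *\<^sub>R x) = c * p x)"

lemma sublinear_add: "sublinear p \<Longrightarrow> p (x + y) \<le> p x + p y"
  and sublinear_scale: "sublinear p \<Longrightarrow> 0 \<le> c \<Longrightarrow> p (c *\<^sub>R x) = c * p x"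
  unfolding sublinear_def by auto

lemma sublinear_0: "sublinear p \<Longrightarrow> p 0 = 0"
  using sublinear_scale[of p 0 0] by simp

lemma sublinear_minus: "sublinear p \<Longrightarrow> - p (- x) \<le> p x"
  using sublinear_add[of p x "- x"] sublinear_0[of p] by simp

text \<open>The functional \<open>q\<close> takes the infimum of
  \<open>p (x + t *\<^sub>R s) - t * \<alpha>\<close> over \<open>t \<ge> 0\<close> and
  \<open>s\<close> in \<open>S\<close>. A linear functional below \<open>q\<close> is below
  \<open>p\<close> and at least \<alpha> on \<open>S\<close>, so the condition on \<open>S\<close>
  is absorbed into the sublinear bound.\<close>

lemma sublinear_lowering:
  fixes p :: "'a::real_vector \<Rightarrow> real"
  assumes p: "sublinear p" and S: "convex S" "S \<noteq> {}" and \<alpha>: "\<And>s. s \<in> S \<Longrightarrow> \<alpha> \<le> p s"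
  obtains q where "sublinear q" "\<And>x. q x \<le> p x" "\<And>s. s \<in> S \<Longrightarrow> q (- s) \<le> - \<alpha>"
proof -
  define Q where "Q x = {p (x + t *\<^sub>R s) - t * \<alpha> | t s. 0 \<le> t \<and> s \<in> S}" for x
  define q where "q x = Inf (Q x)" for x
  \<comment> \<open>This bound does not depend on \<open>t\<close> and \<open>s\<close>, so the
    infimum is finite. It rests on \<alpha> being at most \<open>p\<close> on
    \<open>S\<close>.\<close>
  have lower: "- p (- x) \<le> p (x + t *\<^sub>R s) - t * \<alpha>" if "0 \<le> t" "s \<in> S" for x t s
  proof -
    have "t * \<alpha> \<le> p (t *\<^sub>R s)"
      using that \<alpha> p by (simp add: sublinear_scale mult_left_mono)
    also have "\<dots> \<le> p (x + t *\<^sub>R s) + p (- x)"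
      using sublinear_add[OF p, of "x + t *\<^sub>R s" "- x"] by simp
    finally show ?thesis by simp
  qed
  have Qne: "Q x \<noteq> {}" for x
    using S(2) unfolding Q_def by force
  have bdd: "bdd_below (Q x)" for x
    using lower unfolding Q_def by (auto intro!: bdd_belowI[where m = "- p (- x)"])
  have q_le: "q x \<le> p (x + t *\<^sub>R s) - t * \<alpha>" if "0 \<le> t" "s \<in> S" for x t s
    unfolding q_def using that by (intro cInf_lower[OF _ bdd]) (auto simp: Q_def)
  have q_ge: "m \<le> q x" if "\<And>t s. 0 \<le> t \<Longrightarrow> s \<in> S \<Longrightarrow> m \<le> p (x + t *\<^sub>R s) - t * \<alpha>" for m x
    unfolding q_def using that by (intro cInf_greatest[OF Qne]) (auto simp: Q_def)
  obtain s0 where s0: "s0 \<in> S" using S(2) by auto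
  have qp: "q x \<le> p x" for x
    using q_le[of 0 s0 x] s0 by simp
  have q0: "q 0 = 0"
    using qp[of 0] q_ge[of 0 0] lower[of _ _ 0] by (force simp: sublinear_0[OF p])
  have scale_le: "q (c *\<^sub>R x) \<le> c * q x" if "0 < c" for c x
  proof -
    have "q (c *\<^sub>R x) / c \<le> q x"
    proof (rule q_ge)
      fix t :: real and s assume ts: "0 \<le> t" "s \<in> S"
      have "q (c *\<^sub>R x) \<le> p (c *\<^sub>R x + (c * t) *\<^sub>R s) - c * t * \<alpha>"
        using ts that by (intro q_le) auto
      also have "\<dots> = c * (p (x + t *\<^sub>R s) - t * \<alpha>)"
        using sublinear_scale[OF p, of c "x + t *\<^sub>R s"] that by (simp add: algebra_simps)
      finally show "q (c *\<^sub>R x) / c \<le> p (x + t *\<^sub>R s) - t * \<alpha>"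
        using that by (simp add: field_simps)
    qed
    then show ?thesis using that by (simp add: field_simps)
  qed
  have scale: "q (c *\<^sub>R x) = c * q x" if "0 \<le> c" for c x
  proof (cases "c = 0")
    case False
    then have "0 < c" using that by simp
    then show ?thesis
      using scale_le[of c x] scale_le[of "inverse c" "c *\<^sub>R x"] by (simp add: field_simps)
  qed (simp add: q0)
  have add: "q (x + y) \<le> q x + q y" for x y
  proof -
    have sum: "q (x + y) \<le> (p (x + t *\<^sub>R s) - t * \<alpha>) + (p (y + t' *\<^sub>R s') - t' * \<alpha>)"
      if ts: "0 \<le> t" "s \<in> S" "0 \<le> t'" "s' \<in> S" for t s t' s'
    proof -
      \<comment> \<open>Two multiples are merged into one: if \<open>t + t'\<close> is positive,
        \<open>u\<close> is the convex combination of \<open>s\<close> and \<open>s'\<close> with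
        weights proportional to \<open>t\<close> and \<open>t'\<close>. Convexity of
        \<open>S\<close> enters here.\<close>
      obtain u where u: "u \<in> S" "(t + t') *\<^sub>R u = t *\<^sub>R s + t' *\<^sub>R s'"
      proof (cases "t + t' = 0")
        case True
        then have "t = 0" "t' = 0" using ts by auto
        then show ?thesis using that ts by auto
      next
        case False
        have "(t / (t + t')) *\<^sub>R s + (t' / (t + t')) *\<^sub>R s' \<in> S"
          using ts False by (intro convexD[OF S(1)]) (auto simp: add_divide_distrib[symmetric])
        then show ?thesis using that False by (force simp: scaleR_add_right)
      qed
      have "q (x + y) \<le> p ((x + y) + (t + t') *\<^sub>R u) - (t + t') * \<alpha>"
        using ts u by (intro q_le) auto
      also have "(x + y) + (t + t') *\<^sub>R u = (x + t *\<^sub>R s) + (y + t' *\<^sub>R s')"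
        using u by simp
      also have "p \<dots> \<le> p (x + t *\<^sub>R s) + p (y + t' *\<^sub>R s')"
        by (rule sublinear_add[OF p])
      finally show ?thesis by (simp add: algebra_simps)
    qed
    have "q (x + y) - q x \<le> q y"
    proof (rule q_ge)
      fix t' :: real and s' assume ts': "0 \<le> t'" "s' \<in> S"
      have "q (x + y) - (p (y + t' *\<^sub>R s') - t' * \<alpha>) \<le> q x"
        using sum ts' by (intro q_ge) (smt (verit))
      then show "q (x + y) - q x \<le> p (y + t' *\<^sub>R s') - t' * \<alpha>" by simp
    qed
    then show ?thesis by simp
  qed
  show ?thesis
  proof (rule that)
    show "sublinear q" using add scale unfolding sublinear_def by auto
    show "q (- s) \<le> - \<alpha>" if "s \<in> S" for s
      using q_le[of 1 s "- s"] that sublinear_0[OF p] by simp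
  qed (rule qp)
qed

text \<open>Zorn's lemma; \<open>R\<close> reverses the pointwise order, so a maximal element is
  minimal. The infimum of a chain is finite because every member is at least
  \<open>- p (- x)\<close> at \<open>x\<close>, and subadditive because the smaller of two members
  serves at both points.\<close>

lemma minimal_sublinear:
  fixes p :: "'a::real_vector \<Rightarrow> real"
  assumes p: "sublinear p"
  obtains f where "sublinear f" "\<And>x. f x \<le> p x"
    "\<And>q. sublinear q \<Longrightarrow> (\<And>x. q x \<le> f x) \<Longrightarrow> q = f"
proof -
  define A where "A = {q. sublinear q \<and> (\<forall>x. q x \<le> p x)}"
  define R where "R q r \<longleftrightarrow> (\<forall>x. r x \<le> (q x :: real))" for q r :: "'a \<Rightarrow> real"
  have "\<exists>m\<in>A. \<forall>a\<in>A. R m a \<longrightarrow> a = m"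
  proof (rule predicate_Zorn)
    show "partial_order_on A (relation_of R A)"
      by (rule partial_order_on_relation_ofI) (auto simp: R_def fun_eq_iff intro: order_trans antisym)
  next
    fix C assume C: "C \<in> Chains (relation_of R A)"
    then have CA: "C \<subseteq> A" and chain: "\<And>q r. q \<in> C \<Longrightarrow> r \<in> C \<Longrightarrow> R q r \<or> R r q"
      by (auto simp: Chains_def relation_of_def)
    show "\<exists>u\<in>A. \<forall>a\<in>C. R a u"
    proof (cases "C = {}")
      case True
      then show ?thesis using p by (auto simp: A_def)
    next
      case False
      define u where "u x = (INF q\<in>C. q x)" for x
      have sub: "sublinear q" "q x \<le> p x" if "q \<in> C" for q x
        using CA that by (auto simp: A_def)
      have "- p (- x) \<le> q x" if "q \<in> C" for q x
        using sublinear_minus[OF sub(1)[OF that], of x] sub(2)[OF that, of "- x"] by simp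
      then have bdd: "bdd_below ((\<lambda>q. q x) ` C)" for x
        by (auto intro!: bdd_belowI2)
      have le: "u x \<le> q x" if "q \<in> C" for q x
        unfolding u_def using that by (intro cINF_lower[OF bdd])
      have ge: "m \<le> u x" if "\<And>q. q \<in> C \<Longrightarrow> m \<le> q x" for m x
        unfolding u_def using that False by (intro cINF_greatest) auto
      have add: "u (x + y) \<le> u x + u y" for x y
      proof -
        have "u (x + y) - u x \<le> q y" if q: "q \<in> C" for q
        proof -
          have "u (x + y) - q y \<le> r x" if r: "r \<in> C" for r
          proof -
            obtain m where m: "m \<in> C" "m x \<le> r x" "m y \<le> q y"
              using chain[OF q r] q r unfolding R_def by blast
            then show ?thesis
              using le[OF m(1), of "x + y"] sublinear_add[OF sub(1)[OF m(1)], of x y] by linarith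
          qed
          then show ?thesis using ge[of "u (x + y) - q y" x] by simp
        qed
        then show ?thesis using ge[of "u (x + y) - u x" y] by simp
      qed
      have scale: "u (c *\<^sub>R x) = c * u x" if "0 \<le> c" for c x
      proof (cases "c = 0")
        case True
        then show ?thesis
          using False by (simp add: u_def sublinear_0[OF sub(1)] cong: INF_cong)
      next
        case False
        then have c: "0 < c" using that by simp
        have "u (c *\<^sub>R x) / c \<le> u x"
          using le[of _ "c *\<^sub>R x"] c
          by (intro ge) (auto simp: field_simps sublinear_scale[OF sub(1)])
        moreover have "c * u x \<le> u (c *\<^sub>R x)"
          using le[of _ x] c by (intro ge) (auto simp: sublinear_scale[OF sub(1)])
        ultimately show ?thesis using c by (simp add: field_simps)
      qed
      have "u x \<le> p x" for x
        using False le sub(2) order_trans by blast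
      then have "u \<in> A" using add scale by (auto simp: A_def sublinear_def)
      then show ?thesis using le by (auto simp: R_def)
    qed
  qed
  then obtain m where m: "m \<in> A" "\<And>a. a \<in> A \<Longrightarrow> R m a \<Longrightarrow> a = m" by auto
  show ?thesis
  proof (rule that[of m])
    fix q assume q: "sublinear q" "\<And>x. q x \<le> m x"
    then have "q \<in> A" using m(1) unfolding A_def by (auto intro: order_trans)
    then show "q = m" using m(2) q(2) by (auto simp: R_def)
  qed (use m(1) in \<open>auto simp: A_def\<close>)
qed

text \<open>A minimal sublinear functional below the lowered \<open>q\<close> is odd, and an odd
  sublinear functional is linear, as its inequalities at \<open>- x\<close> reverse those at
  \<open>x\<close>. The bound on \<open>S\<close> is read off at \<open>- s\<close>.\<close>

theorem Hahn_Banach_sublinear: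
  fixes p :: "'a::real_vector \<Rightarrow> real"
  assumes p: "sublinear p" and S: "convex S" "S \<noteq> {}" "\<And>s. s \<in> S \<Longrightarrow> \<alpha> \<le> p s"
  obtains f where "linear f" "\<And>x. f x \<le> p x" "\<And>s. s \<in> S \<Longrightarrow> \<alpha> \<le> f s"
proof -
  obtain q where q: "sublinear q" "\<And>x. q x \<le> p x" "\<And>s. s \<in> S \<Longrightarrow> q (- s) \<le> - \<alpha>"
    using sublinear_lowering[OF assms] by blast
  obtain f where f: "sublinear f" "\<And>x. f x \<le> q x"
    and min: "\<And>r. sublinear r \<Longrightarrow> (\<And>x. r x \<le> f x) \<Longrightarrow> r = f"
    using minimal_sublinear[OF q(1)] by blast
  have odd: "f (- y) = - f y" for y
  proof - \<comment> \<open>lowering \<open>f\<close> at \<open>y\<close> to a functional that is at most \<open>- f y\<close> at \<open>- y\<close> changes nothing, by minimality\<close>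
    obtain r where r: "sublinear r" "\<And>x. r x \<le> f x" "r (- y) \<le> - f y"
      using sublinear_lowering[OF f(1), of "{y}" "f y"] by auto
    then have "r = f" using min by blast
    then show ?thesis using r(3) sublinear_minus[OF f(1), of y] by simp
  qed
  have lin: "linear f"
  proof (rule linearI)
    show "f (x + y) = f x + f y" for x y
      using sublinear_add[OF f(1), of x y] sublinear_add[OF f(1), of "- x" "- y"]
        odd[of x] odd[of y] odd[of "x + y"] by simp
    show "f (c *\<^sub>R x) = c *\<^sub>R f x" for c x
      using sublinear_scale[OF f(1), of c x] sublinear_scale[OF f(1), of "- c" x] odd[of "c *\<^sub>R x"]
      by (cases "0 \<le> c") auto
  qed
  show ?thesis
  proof (rule that[OF lin])
    show "f x \<le> p x" for x using f(2) q(2) order_trans by blast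
    show "\<alpha> \<le> f s" if "s \<in> S" for s
      using f(2)[of "- s"] q(3)[OF that] odd[of s] by linarith
  qed
qed

subsection \<open>Separation in locally convex spaces\<close>

text \<open>The Minkowski functional of \<open>V\<close>, unrelated to the gauges of
  Henstock-Kurzweil integration.\<close>

definition gauge_fun :: "'a::real_vector set \<Rightarrow> 'a \<Rightarrow> real" where
  "gauge_fun V x = Inf {t. 0 < t \<and> x /\<^sub>R t \<in> V}"

locale locally_convex =
  fixes \<rho> :: "'a::real_vector topology"
  assumes lc: "locally_convex_topology \<rho>"
begin

lemma topspace_eq [simp]: "topspace \<rho> = UNIV"
  using lc by (simp add: locally_convex_topology_def)

lemma continuous_map_plus:
  assumes "continuous_map X \<rho> f" "continuous_map X \<rho> g"
  shows "continuous_map X \<rho> (\<lambda>x. f x + g x)"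
proof -
  have "continuous_map X (prod_topology \<rho> \<rho>) (\<lambda>x. (f x, g x))"
    using assms by (simp add: continuous_map_pairedI)
  moreover have "continuous_map (prod_topology \<rho> \<rho>) \<rho> (\<lambda>(x, y). x + y)"
    using lc by (simp add: locally_convex_topology_def)
  ultimately have "continuous_map X \<rho> ((\<lambda>(x, y). x + y) \<circ> (\<lambda>x. (f x, g x)))"
    by (rule continuous_map_compose)
  then show ?thesis by (simp add: o_def)
qed

lemma continuous_map_scale:
  assumes "continuous_map X euclideanreal f" "continuous_map X \<rho> g"
  shows "continuous_map X \<rho> (\<lambda>x. f x *\<^sub>R g x)"
proof -
  have "continuous_map X (prod_topology euclideanreal \<rho>) (\<lambda>x. (f x, g x))"
    using assms by (simp add: continuous_map_pairedI)
  moreover have "continuous_map (prod_topology euclideanreal \<rho>) \<rho> (\<lambda>(x, y). x *\<^sub>R y)"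
    using lc by (simp add: locally_convex_topology_def)
  ultimately have "continuous_map X \<rho> ((\<lambda>(x, y). x *\<^sub>R y) \<circ> (\<lambda>x. (f x, g x)))"
    by (rule continuous_map_compose)
  then show ?thesis by (simp add: o_def)
qed

lemma openin_affine:
  assumes "openin \<rho> U"
  shows "openin \<rho> {x. c *\<^sub>R (x - a) \<in> U}"
proof -
  have "continuous_map \<rho> \<rho> (\<lambda>x. c *\<^sub>R (x + (- a)))"
    by (intro continuous_map_scale continuous_map_plus) auto
  from openin_continuous_map_preimage[OF this assms] show ?thesis by simp
qed

lemma openin_translate: "openin \<rho> U \<Longrightarrow> openin \<rho> {x. x - a \<in> U}"
  using openin_affine[of U 1 a] by simp

text \<open>Take a convex \<open>W\<close> inside \<open>U\<close> and intersect its halves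
  \<open>W / 2\<close> and \<open>- W / 2\<close>; then \<open>x + y\<close> is the midpoint of
  \<open>2 *\<^sub>R x\<close> and \<open>2 *\<^sub>R y\<close>. This plays the part of an epsilon/2
  argument.\<close>

lemma symmetric_convex_half:
  assumes U: "openin \<rho> U" "0 \<in> U"
  obtains V where "openin \<rho> V" "0 \<in> V" "convex V" "\<And>x. x \<in> V \<Longrightarrow> - x \<in> V"
    "\<And>x y. x \<in> V \<Longrightarrow> y \<in> V \<Longrightarrow> x + y \<in> U"
proof -
  obtain W where W: "openin \<rho> W" "0 \<in> W" "convex W" "W \<subseteq> U"
    using lc U unfolding locally_convex_topology_def by metis
  define V where "V = {x. 2 *\<^sub>R (x - 0) \<in> W} \<inter> {x. (- 2) *\<^sub>R (x - 0) \<in> W}"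
  have "openin \<rho> V"
    unfolding V_def by (intro openin_Int openin_affine W)
  moreover have "convex V"
  proof -
    have "V = (\<lambda>x. 2 *\<^sub>R x) -` W \<inter> (\<lambda>x. (- 2) *\<^sub>R x) -` W" by (auto simp: V_def)
    moreover have "convex ((\<lambda>x. c *\<^sub>R x) -` W)" for c
      using W(3) by (intro convex_linear_vimage) auto
    ultimately show ?thesis by (simp add: convex_Int del: scaleR_minus_left)
  qed
  moreover have "x + y \<in> U" if "x \<in> V" "y \<in> V" for x y
  proof -
    have "(1/2) *\<^sub>R (2 *\<^sub>R x) + (1/2) *\<^sub>R (2 *\<^sub>R y) \<in> W"
      using that W(3) by (intro convexD) (auto simp: V_def)
    then show ?thesis using W(4) by auto
  qed
  ultimately show ?thesis
    using that[of V] W(2) by (auto simp: V_def)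
qed

lemma symmetric_convex:
  assumes U: "openin \<rho> U" "0 \<in> U"
  obtains V where "openin \<rho> V" "0 \<in> V" "convex V" "\<And>x. x \<in> V \<Longrightarrow> - x \<in> V" "V \<subseteq> U"
proof -
  obtain V where V: "openin \<rho> V" "0 \<in> V" "convex V" "\<And>x. x \<in> V \<Longrightarrow> - x \<in> V"
    and sum: "\<And>x y. x \<in> V \<Longrightarrow> y \<in> V \<Longrightarrow> x + y \<in> U"
    using symmetric_convex_half[OF U] by blast
  have "V \<subseteq> U" using sum[of _ 0] V(2) by auto
  then show ?thesis using that V by blast
qed

lemma absorbing:
  assumes V: "openin \<rho> V" "0 \<in> V"
  obtains t where "0 < t" "\<And>s. \<bar>s\<bar> \<le> t \<Longrightarrow> s *\<^sub>R x \<in> V"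
proof -
  have "continuous_map euclideanreal \<rho> (\<lambda>c. c *\<^sub>R x)"
    by (intro continuous_map_scale) auto
  from openin_continuous_map_preimage[OF this V(1)] have "open {c. c *\<^sub>R x \<in> V}" by simp
  moreover have "0 \<in> {c. c *\<^sub>R x \<in> V}" using V by simp
  ultimately obtain e where e: "e > 0" "cball 0 e \<subseteq> {c. c *\<^sub>R x \<in> V}"
    unfolding open_contains_cball by blast
  then show ?thesis using that[of e] by (auto simp: subset_eq)
qed

lemma limitin_iff:
  "limitin \<rho> f l F \<longleftrightarrow> (\<forall>U. openin \<rho> U \<and> 0 \<in> U \<longrightarrow> (\<forall>\<^sub>F x in F. f x - l \<in> U))"
proof
  assume l: "limitin \<rho> f l F"
  show "\<forall>U. openin \<rho> U \<and> 0 \<in> U \<longrightarrow> (\<forall>\<^sub>F x in F. f x - l \<in> U)"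
    using l openin_translate[of _ l] unfolding limitin_def by fastforce
next
  assume R: "\<forall>U. openin \<rho> U \<and> 0 \<in> U \<longrightarrow> (\<forall>\<^sub>F x in F. f x - l \<in> U)"
  show "limitin \<rho> f l F"
    unfolding limitin_def
  proof (intro conjI allI impI)
    fix U assume U: "openin \<rho> U \<and> l \<in> U"
    then have "openin \<rho> {x. x - (- l) \<in> U}" by (intro openin_translate) auto
    then have "\<forall>\<^sub>F x in F. f x - l \<in> {x. x - (- l) \<in> U}"
      using R[rule_format, of "{x. x - (- l) \<in> U}"] U by auto
    then show "\<forall>\<^sub>F x in F. f x \<in> U" by simp
  qed simp
qed

lemma limitin_diff:
  assumes f: "limitin \<rho> f l F" and g: "limitin \<rho> g l' F"
  shows "limitin \<rho> (\<lambda>x. f x - g x) (l - l') F"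
  unfolding limitin_iff
proof (intro allI impI)
  fix U assume "openin \<rho> U \<and> 0 \<in> U"
  then obtain V where V: "openin \<rho> V" "0 \<in> V" "convex V" "\<And>x. x \<in> V \<Longrightarrow> - x \<in> V"
    and sum: "\<And>x y. x \<in> V \<Longrightarrow> y \<in> V \<Longrightarrow> x + y \<in> U"
    using symmetric_convex_half by blast
  have "\<forall>\<^sub>F x in F. f x - l \<in> V" "\<forall>\<^sub>F x in F. g x - l' \<in> V"
    using f g V(1,2) unfolding limitin_iff by blast+
  then show "\<forall>\<^sub>F x in F. f x - g x - (l - l') \<in> U"
  proof eventually_elim
    case (elim x)
    then show ?case using sum[OF elim(1) V(4)[OF elim(2)]] by (simp add: algebra_simps)
  qed
qed

text \<open>By homogeneity \<open>f\<close> varies by at most \<open>e / 2\<close> on the translate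
  of \<open>(e / 2) V\<close> to any point, so boundedness near 0 gives continuity
  everywhere.\<close>

lemma linear_in_top_dual:
  assumes f: "linear f" and V: "openin \<rho> V" "0 \<in> V" and bd: "\<And>x. x \<in> V \<Longrightarrow> \<bar>f x\<bar> \<le> (1::real)"
  shows "f \<in> top_dual \<rho>"
proof -
  have "openin \<rho> {x. f x \<in> W}" if W: "open W" for W
  proof (subst openin_subopen, clarify)
    fix x assume "f x \<in> W"
    then obtain e where e: "e > 0" "ball (f x) e \<subseteq> W"
      using W open_contains_ball by metis
    have "f z \<in> W" if z: "(2 / e) *\<^sub>R (z - x) \<in> V" for z
    proof -
      have "f ((2 / e) *\<^sub>R (z - x)) = (2 / e) * (f z - f x)"
        by (simp only: linear_scale[OF f] linear_diff[OF f] real_scaleR_def)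
      then have "\<bar>(2 / e) * (f z - f x)\<bar> \<le> 1"
        using bd[OF z] by simp
      then have "(2 / e) * \<bar>f z - f x\<bar> \<le> 1" using e(1) by (simp add: abs_if field_simps split: if_splits)
      then have "\<bar>f z - f x\<bar> < e" using e(1) by (simp add: pos_divide_le_eq)
      then show ?thesis using e(2) by (auto simp: dist_real_def subset_eq)
    qed
    moreover have "openin \<rho> {z. (2 / e) *\<^sub>R (z - x) \<in> V}" by (rule openin_affine[OF V(1)])
    ultimately show "\<exists>T. openin \<rho> T \<and> x \<in> T \<and> T \<subseteq> {x. f x \<in> W}"
      using V(2) by (intro exI[of _ "{z. (2 / e) *\<^sub>R (z - x) \<in> V}"]) auto
  qed
  then have "continuous_map \<rho> euclideanreal f"
    by (auto simp: continuous_map_def)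
  then show ?thesis using f by (simp add: top_dual_def)
qed

text \<open>Subadditivity comes from the convex combination of \<open>x /\<^sub>R s\<close> and
  \<open>y /\<^sub>R t\<close> with weights proportional to \<open>s\<close> and \<open>t\<close>.
  The lower bound off \<open>V\<close> holds because a convex \<open>V\<close> containing 0 is
  star-shaped about 0.\<close>

lemma sublinear_gauge_fun:
  assumes V: "openin \<rho> V" "0 \<in> V" "convex V"
  shows "sublinear (gauge_fun V)"
    and "x \<in> V \<Longrightarrow> gauge_fun V x \<le> 1"
    and "x \<notin> V \<Longrightarrow> 1 \<le> gauge_fun V x"
proof -
  let ?g = "gauge_fun V"
  let ?S = "\<lambda>x. {t. 0 < t \<and> x /\<^sub>R t \<in> V}"
  have bdd: "bdd_below (?S x)" for x by (rule bdd_belowI[of _ 0]) auto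
  have ne: "?S x \<noteq> {}" for x
  proof -
    obtain t where t: "0 < t" "\<And>s. \<bar>s\<bar> \<le> t \<Longrightarrow> s *\<^sub>R x \<in> V"
      using absorbing[OF V(1,2)] by blast
    then have "t *\<^sub>R x \<in> V" using t(2)[of t] by simp
    with t(1)
    show ?thesis by (auto intro!: exI[of _ "inverse t"])
  qed
  have le: "?g x \<le> t" if "0 < t" "x /\<^sub>R t \<in> V" for x t
    unfolding gauge_fun_def using that by (intro cInf_lower[OF _ bdd]) auto
  have ge: "m \<le> ?g x" if "\<And>t. 0 < t \<Longrightarrow> x /\<^sub>R t \<in> V \<Longrightarrow> m \<le> t" for m x
    unfolding gauge_fun_def using that by (intro cInf_greatest[OF ne]) auto
  have g0: "?g 0 = 0"
  proof (rule antisym)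
    show "?g 0 \<le> 0"
    proof (rule field_le_epsilon)
      fix e :: real assume "0 < e"
      then show "?g 0 \<le> 0 + e" using le[of e 0] V(2) by simp
    qed
  qed (auto intro!: ge)
  have add: "?g (x + y) \<le> ?g x + ?g y" for x y
  proof -
    have *: "?g (x + y) \<le> s + t" if st: "0 < s" "x /\<^sub>R s \<in> V" "0 < t" "y /\<^sub>R t \<in> V" for s t
    proof (rule le)
      have "(s / (s + t)) *\<^sub>R (x /\<^sub>R s) + (t / (s + t)) *\<^sub>R (y /\<^sub>R t) \<in> V"
        using st by (intro convexD[OF V(3)]) (auto simp: add_divide_distrib[symmetric])
      moreover have "(s / (s + t)) *\<^sub>R (x /\<^sub>R s) = x /\<^sub>R (s + t)"
        "(t / (s + t)) *\<^sub>R (y /\<^sub>R t) = y /\<^sub>R (s + t)"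
        using st by (simp_all add: field_simps)
      ultimately show "(x + y) /\<^sub>R (s + t) \<in> V"
        by (simp only: scaleR_add_right)
    qed (use st in auto)
    have "?g (x + y) - ?g x \<le> ?g y"
    proof (rule ge)
      fix t :: real assume t: "0 < t" "y /\<^sub>R t \<in> V"
      have "?g (x + y) - t \<le> ?g x" using * t by (intro ge) (smt (verit))
      then show "?g (x + y) - ?g x \<le> t" by simp
    qed
    then show ?thesis by simp
  qed
  have scale_le: "?g (c *\<^sub>R x) \<le> c * ?g x" if c: "0 < c" for c x
  proof -
    have "?g (c *\<^sub>R x) / c \<le> ?g x"
    proof (rule ge)
      fix t :: real assume t: "0 < t" "x /\<^sub>R t \<in> V"
      have "(c *\<^sub>R x) /\<^sub>R (c * t) = x /\<^sub>R t" using c by simp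
      then have "?g (c *\<^sub>R x) \<le> c * t"
        using c t(1) t(2) by (intro le) (simp_all only: mult_pos_pos)
      then show "?g (c *\<^sub>R x) / c \<le> t" using c by (simp add: field_simps)
    qed
    then show ?thesis using c by (simp add: field_simps)
  qed
  have scale: "?g (c *\<^sub>R x) = c * ?g x" if "0 \<le> c" for c x
  proof (cases "c = 0")
    case False
    then have "0 < c" using that by simp
    then show ?thesis
      using scale_le[of c x] scale_le[of "inverse c" "c *\<^sub>R x"] by (simp add: field_simps)
  qed (simp add: g0)
  show "sublinear ?g" using add scale by (auto simp: sublinear_def)
  show "?g x \<le> 1" if "x \<in> V" for x using le[of 1 x] that by simp
  show "1 \<le> ?g x" if x: "x \<notin> V" for x
  proof (rule ge)
    fix t :: real assume t: "0 < t" "x /\<^sub>R t \<in> V"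
    show "1 \<le> t"
    proof (rule ccontr)
      assume "\<not> 1 \<le> t"
      then have "t *\<^sub>R (x /\<^sub>R t) + (1 - t) *\<^sub>R 0 \<in> V"
        using t V by (intro convexD) auto
      then show False using t x by simp
    qed
  qed
qed

text \<open>Hahn-Banach is applied to the Minkowski functional of \<open>V\<close>, which is at
  least 1 on \<open>S\<close> because \<open>S\<close> misses \<open>V\<close>. The resulting
  \<open>f\<close> is continuous: on a symmetric neighbourhood inside \<open>V\<close> the bound
  from above also bounds the absolute value.\<close>

theorem separation:
  assumes V: "openin \<rho> V" "0 \<in> V" "convex V" and S: "convex S" "S \<noteq> {}" "S \<inter> V = {}"
  obtains f where "f \<in> top_dual \<rho>" "\<And>x. x \<in> V \<Longrightarrow> f x \<le> 1" "\<And>s. s \<in> S \<Longrightarrow> 1 \<le> f s"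
proof -
  note g = sublinear_gauge_fun[OF V]
  obtain f where f: "linear f" "\<And>x. f x \<le> gauge_fun V x" "\<And>s. s \<in> S \<Longrightarrow> 1 \<le> f s"
    using Hahn_Banach_sublinear[OF g(1) S(1,2), of 1] g(3) S(3) by blast
  have f1: "f x \<le> 1" if "x \<in> V" for x using f(2) g(2)[OF that] order_trans by blast
  obtain W where W: "openin \<rho> W" "0 \<in> W" "convex W" "\<And>x. x \<in> W \<Longrightarrow> - x \<in> W" "W \<subseteq> V"
    by (rule symmetric_convex[OF V(1,2)]) (rule that)
  have "f \<in> top_dual \<rho>"
  proof (rule linear_in_top_dual[OF f(1) W(1,2)])
    fix x assume "x \<in> W"
    then have "f x \<le> 1" "f (- x) \<le> 1" using W f1 by auto
    then show "\<bar>f x\<bar> \<le> 1" using f(1) by (simp add: linear_neg)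
  qed
  then show ?thesis by (rule that) (fact f1, fact f(3))
qed

text \<open>Separating a single point from \<open>V\<close> yields only the weak inequality
  \<open>1 \<le> f z\<close>, hence the strict one in the assumption.\<close>

corollary in_nbhd_by_duality:
  assumes V: "openin \<rho> V" "0 \<in> V" "convex V"
    and z: "\<And>f. f \<in> top_dual \<rho> \<Longrightarrow> (\<And>x. x \<in> V \<Longrightarrow> f x \<le> 1) \<Longrightarrow> f z < 1"
  shows "z \<in> V"
proof (rule ccontr)
  assume "z \<notin> V"
  then obtain f where "f \<in> top_dual \<rho>" "\<And>x. x \<in> V \<Longrightarrow> f x \<le> 1" "1 \<le> f z"
    using separation[OF V, of "{z}"] by auto
  then show False using z[of f] by simp
qed

end

subsection \<open>Riemann sums\<close>

definition riemann_sum :: "(real \<Rightarrow> 'a::real_vector) \<Rightarrow> (real \<times> real set) set \<Rightarrow> 'a" where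
  "riemann_sum f p = (\<Sum>(s, K)\<in>p. measure lborel K *\<^sub>R f s)"

text \<open>Expresses the mesh condition of \<open>has_riemann_integral\<close> as a filter, so that
  the integral becomes an ordinary limit of Riemann sums.\<close>

definition mesh_filter :: "real \<Rightarrow> real \<Rightarrow> (real \<times> real set) set filter" where
  "mesh_filter a b = (INF \<delta>\<in>{0<..}.
     principal {p. p tagged_division_of {a..b} \<and> (\<forall>(s, K)\<in>p. diameter K < \<delta>)})"

lemma eventually_mesh_filter:
  "eventually P (mesh_filter a b) \<longleftrightarrow>
     (\<exists>\<delta>>0. \<forall>p. p tagged_division_of {a..b} \<and> (\<forall>(s, K)\<in>p. diameter K < \<delta>) \<longrightarrow> P p)"
proof -
  have "eventually P (mesh_filter a b) \<longleftrightarrow> (\<exists>\<delta>\<in>{0<..}. eventually P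
     (principal {p. p tagged_division_of {a..b} \<and> (\<forall>(s, K)\<in>p. diameter K < \<delta>)}))"
    unfolding mesh_filter_def
  proof (rule eventually_INF_base)
    fix \<delta> \<epsilon> :: real assume "\<delta> \<in> {0<..}" "\<epsilon> \<in> {0<..}"
    then show "\<exists>x\<in>{0<..}.
      principal {p. p tagged_division_of {a..b} \<and> (\<forall>(s, K)\<in>p. diameter K < x)}
      \<le> inf (principal {p. p tagged_division_of {a..b} \<and> (\<forall>(s, K)\<in>p. diameter K < \<delta>)})
          (principal {p. p tagged_division_of {a..b} \<and> (\<forall>(s, K)\<in>p. diameter K < \<epsilon>)})"
      by (intro bexI[of _ "min \<delta> \<epsilon>"]) auto
  qed auto
  then show ?thesis by (auto simp: eventually_principal)
qed

lemma eventually_tagged_division: "eventually (\<lambda>p. p tagged_division_of {a..b}) (mesh_filter a b)"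
  unfolding eventually_mesh_filter by (intro exI[of _ 1]) auto

lemma fine_tagged_division_exists:
  fixes a b \<delta> :: real
  assumes "0 < \<delta>"
  obtains p where "p tagged_division_of {a..b}" "\<And>s K. (s, K) \<in> p \<Longrightarrow> diameter K < \<delta>"
proof -
  \<comment> \<open>Balls of radius \<open>\<delta> / 3\<close> have diameter
    \<open>2 * \<delta> / 3\<close>, strictly below \<delta>.\<close>
  have "gauge (\<lambda>x :: real. ball x (\<delta> / 3))" using assms by (intro gauge_ball) auto
  then obtain p where p: "p tagged_division_of {a..b}" "(\<lambda>x. ball x (\<delta> / 3)) fine p"
    by (rule fine_division_exists_real)
  show ?thesis
  proof (rule that[OF p(1)])
    fix s K assume "(s, K) \<in> p"
    then have "K \<subseteq> ball s (\<delta> / 3)" using p(2) by (auto simp: fine_def)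
    then have "diameter K \<le> diameter (ball s (\<delta> / 3))" by (intro diameter_subset) auto
    then show "diameter K < \<delta>" using assms by simp
  qed
qed

lemma mesh_filter_neq_bot: "mesh_filter a b \<noteq> bot"
proof
  assume "mesh_filter a b = bot"
  then have "eventually (\<lambda>_. False) (mesh_filter a b)" by simp
  then obtain \<delta> where \<delta>: "0 < \<delta>"
      "\<And>p. p tagged_division_of {a..b} \<Longrightarrow> \<not> (\<forall>(s, K)\<in>p. diameter K < \<delta>)"
    unfolding eventually_mesh_filter by auto
  show False
    by (rule fine_tagged_division_exists[OF \<delta>(1), of a b]) (use \<delta>(2) in fast)
qed

text \<open>Completeness and bi-continuity are assumed for sequences only, so limits along the mesh
  filter have to be probed by a sequence of divisions.\<close>

lemma filterlim_mesh_filter_sequence: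
  obtains P where "filterlim P (mesh_filter a b) sequentially" "\<And>n. P n tagged_division_of {a..b}"
proof -
  have "\<exists>p. p tagged_division_of {a..b} \<and> (\<forall>(s, K)\<in>p. diameter K < inverse (real (Suc n)))" for n
    by (rule fine_tagged_division_exists[of "inverse (real (Suc n))" a b]) auto
  then obtain P where P: "\<And>n. P n tagged_division_of {a..b}"
      "\<And>n. \<forall>(s, K)\<in>P n. diameter K < inverse (real (Suc n))"
    by metis
  have "filterlim P (mesh_filter a b) sequentially"
    unfolding filterlim_iff eventually_mesh_filter
  proof clarify
    fix Q \<delta> assume \<delta>: "(0 :: real) < \<delta>"
      and Q: "\<forall>p. p tagged_division_of {a..b} \<and> (\<forall>(s, K)\<in>p. diameter K < \<delta>) \<longrightarrow> Q p"
    have "\<forall>\<^sub>F n in sequentially. inverse (real (Suc n)) < \<delta>"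
      using LIMSEQ_inverse_real_of_nat \<delta> by (rule order_tendstoD)
    then show "\<forall>\<^sub>F n in sequentially. Q (P n)"
    proof eventually_elim
      case (elim n)
      then have "\<forall>(s, K)\<in>P n. diameter K < \<delta>" using P(2)[of n] by (auto split: prod.splits)
      then show ?case using P(1) Q by blast
    qed
  qed
  then show ?thesis using that P(1) by blast
qed

lemma has_riemann_integral_iff_limitin:
  "has_riemann_integral \<tau> f a b y \<longleftrightarrow> limitin \<tau> (riemann_sum f) y (mesh_filter a b)"
  unfolding has_riemann_integral_def limitin_def eventually_mesh_filter riemann_sum_def ..

lemma linear_riemann_sum: "linear \<phi> \<Longrightarrow> \<phi> (riemann_sum f p) = riemann_sum (\<lambda>s. \<phi> (f s)) p"
  unfolding riemann_sum_def by (simp add: linear_sum linear_scale case_prod_unfold)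

lemma norm_riemann_sum_le:
  fixes f :: "real \<Rightarrow> 'a::real_normed_vector"
  assumes "p tagged_division_of {a..b}" "a \<le> b" "\<And>s. s \<in> {a..b} \<Longrightarrow> norm (f s) \<le> B"
  shows "norm (riemann_sum f p) \<le> B * (b - a)"
  using rsum_bound[of p a b f B] assms by (simp add: riemann_sum_def)

text \<open>On each interval of the division \<open>h\<close> stays within \<epsilon> of its value
  at the tag. The bound depends on \<open>h\<close> only through \<delta> and \<epsilon>, so it
  holds at once for all functions sharing this modulus of continuity; the vector-valued integral
  relies on that uniformity.\<close>

lemma riemann_sum_integral_error:
  fixes h :: "real \<Rightarrow> real"
  assumes h: "continuous_on {a..b} h" and "a \<le> b"
    and osc: "\<And>s t. s \<in> {a..b} \<Longrightarrow> t \<in> {a..b} \<Longrightarrow> \<bar>s - t\<bar> < \<delta> \<Longrightarrow> \<bar>h s - h t\<bar> \<le> \<epsilon>"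
    and p: "p tagged_division_of {a..b}" "\<And>s K. (s, K) \<in> p \<Longrightarrow> diameter K < \<delta>"
    and "0 \<le> \<epsilon>"
  shows "\<bar>riemann_sum h p - integral {a..b} h\<bar> \<le> \<epsilon> * (b - a)"
proof -
  have int: "h integrable_on {a..b}" using h by (rule integrable_continuous_interval)
  have "integral {a..b} h = (\<Sum>(s, K)\<in>p. integral K h)"
    using integral_combine_tagged_division_topdown[of h a b p] int p by simp
  then have "riemann_sum h p - integral {a..b} h
      = (\<Sum>(s, K)\<in>p. measure lborel K *\<^sub>R h s - integral K h)"
    by (simp add: riemann_sum_def sum_subtractf case_prod_unfold)
  also have "\<bar>\<dots>\<bar> \<le> (\<Sum>(s, K)\<in>p. \<epsilon> * measure lborel K)"
  proof (rule order_trans[OF sum_abs], rule sum_mono, clarify)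
    fix s K assume sK: "(s, K) \<in> p"
    obtain c d where K: "K = cbox c d" using tagged_division_ofD(4)[OF p(1) sK] by auto
    have s: "s \<in> K" and sub: "K \<subseteq> {a..b}" using tagged_division_ofD(2,3)[OF p(1) sK] by auto
    have "h integrable_on K"
      using int sub unfolding K by (metis integrable_on_subcbox box_real(2))
    then have "((\<lambda>x. h s - h x) has_integral (measure lborel K *\<^sub>R h s - integral K h)) (cbox c d)"
      unfolding K by (intro has_integral_diff has_integral_const integrable_integral)
    moreover have "norm (h s - h x) \<le> \<epsilon>" if "x \<in> cbox c d" for x
    proof -
      have "dist s x \<le> diameter K"
        using s that unfolding K by (intro diameter_bounded_bound) auto
      then show ?thesis
        using p(2)[OF sK] osc[of s x] s sub that K by (auto simp: dist_real_def)
    qed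
    ultimately have "norm (measure lborel K *\<^sub>R h s - integral K h) \<le> \<epsilon> * measure lborel K"
      unfolding K using \<open>0 \<le> \<epsilon>\<close> by (intro has_integral_bound) auto
    then show "\<bar>measure lborel K *\<^sub>R h s - integral K h\<bar> \<le> \<epsilon> * measure lborel K" by simp
  qed
  also have "\<dots> = \<epsilon> * (b - a)"
    using additive_content_tagged_division[of p a b] p(1) \<open>a \<le> b\<close>
    by (simp add: sum_distrib_left[symmetric] case_prod_unfold)
  finally show ?thesis .
qed

lemma tendsto_riemann_sum:
  fixes h :: "real \<Rightarrow> real"
  assumes h: "continuous_on {a..b} h" and ab: "a \<le> b"
  shows "(riemann_sum h \<longlongrightarrow> integral {a..b} h) (mesh_filter a b)"
proof (rule tendstoI)
  fix e :: real assume e: "0 < e"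
  \<comment> \<open>The added 1 keeps the denominator positive when \<open>a = b\<close> and makes
    the final bound strict.\<close>
  define \<epsilon> where "\<epsilon> = e / (b - a + 1)"
  have \<epsilon>: "0 < \<epsilon>" "\<epsilon> * (b - a) < e"
    using e ab by (auto simp: \<epsilon>_def field_simps)
  have "uniformly_continuous_on {a..b} h" using h by (intro compact_uniformly_continuous) auto
  then obtain \<delta> where \<delta>: "0 < \<delta>"
      "\<And>s t. s \<in> {a..b} \<Longrightarrow> t \<in> {a..b} \<Longrightarrow> \<bar>s - t\<bar> < \<delta> \<Longrightarrow> \<bar>h s - h t\<bar> < \<epsilon>"
    using \<epsilon>(1) unfolding uniformly_continuous_on_def by (metis dist_real_def)
  have "dist (riemann_sum h p) (integral {a..b} h) < e"
    if "p tagged_division_of {a..b}" "\<forall>(s, K)\<in>p. diameter K < \<delta>" for p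
  proof -
    have "\<bar>riemann_sum h p - integral {a..b} h\<bar> \<le> \<epsilon> * (b - a)"
    proof (rule riemann_sum_integral_error[OF h ab, where \<delta> = \<delta>])
      show "\<bar>h s - h t\<bar> \<le> \<epsilon>" if "s \<in> {a..b}" "t \<in> {a..b}" "\<bar>s - t\<bar> < \<delta>" for s t
        using \<delta>(2)[OF that] by simp
    qed (use that \<epsilon> in auto)
    then show ?thesis using \<epsilon>(2) by (simp add: dist_real_def)
  qed
  then show "\<forall>\<^sub>F p in mesh_filter a b. dist (riemann_sum h p) (integral {a..b} h) < e"
    unfolding eventually_mesh_filter using \<delta>(1) by blast
qed

text \<open>A Lebesgue number argument: the interval is covered by relatively open sets on which
  \<open>f\<close> stays in \<open>f u + V\<close>, and two points closer than a Lebesgue number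
  share such a \<open>u\<close>.\<close>

lemma (in locally_convex) uniformly_continuous:
  assumes f: "continuous_map (top_of_set {a..b::real}) \<rho> f" and U: "openin \<rho> U" "0 \<in> U"
  obtains \<delta> where "0 < \<delta>"
    "\<And>s t. s \<in> {a..b} \<Longrightarrow> t \<in> {a..b} \<Longrightarrow> \<bar>s - t\<bar> < \<delta> \<Longrightarrow> f s - f t \<in> U"
proof -
  obtain V where V: "openin \<rho> V" "0 \<in> V" "convex V" "\<And>x. x \<in> V \<Longrightarrow> - x \<in> V"
    and sum: "\<And>x y. x \<in> V \<Longrightarrow> y \<in> V \<Longrightarrow> x + y \<in> U"
    using symmetric_convex_half[OF U] by blast
  have "\<exists>G. open G \<and> {s \<in> {a..b}. f s - f t \<in> V} = {a..b} \<inter> G" for t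
  proof -
    have "openin (top_of_set {a..b}) {s \<in> {a..b}. f s \<in> {x. x - f t \<in> V}}"
      using openin_continuous_map_preimage[OF f openin_translate[OF V(1), of "f t"]] by simp
    then show ?thesis unfolding openin_open by auto
  qed
  then obtain G where G: "\<And>t. open (G t)"
      "\<And>t. {s \<in> {a..b}. f s - f t \<in> V} = {a..b} \<inter> G t"
    by metis
  have "{a..b} \<subseteq> \<Union>(G ` {a..b})" using G(2) V(2) by fastforce
  then obtain \<delta> where \<delta>: "0 < \<delta>" "\<And>s. s \<in> {a..b} \<Longrightarrow> \<exists>g\<in>G ` {a..b}. ball s \<delta> \<subseteq> g"
    using Heine_Borel_lemma[of "{a..b}" "G ` {a..b}"] G(1) by (metis compact_Icc imageE)
  show ?thesis
  proof (rule that[OF \<delta>(1)])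
    fix s t assume st: "s \<in> {a..b}" "t \<in> {a..b}" "\<bar>s - t\<bar> < \<delta>"
    then obtain u where "u \<in> {a..b}" "ball s \<delta> \<subseteq> G u" using \<delta>(2) by blast
    then have "s \<in> G u" "t \<in> G u" using st \<delta>(1) by (auto simp: dist_real_def)
    then have "f s - f u \<in> V" "f t - f u \<in> V" using G(2) st by blast+
    then show "f s - f t \<in> U" using sum[OF _ V(4), of "f s - f u" "f t - f u"] by simp
  qed
qed

subsection \<open>The mixed topology and Riemann integrals\<close>

locale bicontinuous_space = locally_convex \<tau> for \<tau> :: "'a::banach topology" +
  fixes \<tau>\<^sub>m :: "'a topology"
  assumes setting: "bicontinuous_setting \<tau>" and mixed: "is_mixed_topology \<tau> \<tau>\<^sub>m"
begin

sublocale m: locally_convex \<tau>\<^sub>m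
  using mixed by (unfold_locales) (simp add: is_mixed_topology_def)

lemma openin_imp_open: "openin \<tau> U \<Longrightarrow> open U"
  using setting by (simp add: bicontinuous_setting_def)

lemma norming: "norm x = (SUP \<phi>\<in>{\<phi> \<in> top_dual \<tau>. onorm \<phi> \<le> 1}. \<bar>\<phi> x\<bar>)"
  using setting by (simp add: bicontinuous_setting_def)

lemma subtopology_mixed: "bounded B \<Longrightarrow> subtopology \<tau>\<^sub>m B = subtopology \<tau> B"
  using mixed by (simp add: is_mixed_topology_def agrees_on_bounded_def)

lemma mixed_finest:
  "locally_convex_topology \<rho> \<Longrightarrow> agrees_on_bounded \<rho> \<tau> \<Longrightarrow> openin \<rho> U \<Longrightarrow> openin \<tau>\<^sub>m U"
  using mixed by (simp add: is_mixed_topology_def)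

lemma top_dual_subset_mixed: "top_dual \<tau> \<subseteq> top_dual \<tau>\<^sub>m"
proof -
  have "openin \<tau>\<^sub>m U" if "openin \<tau> U" for U
    using mixed_finest[OF lc _ that] by (simp add: agrees_on_bounded_def)
  then show ?thesis by (auto simp: top_dual_def continuous_map_def)
qed

text \<open>As \<tau> is coarser than the norm topology, \<phi> is bounded by 1 on some norm ball,
  and homogeneity gives the rest.\<close>

lemma bounded_linear_top_dual:
  assumes "\<phi> \<in> top_dual \<tau>"
  shows "bounded_linear \<phi>"
proof -
  have lin: "linear \<phi>" and cont: "continuous_map \<tau> euclideanreal \<phi>"
    using assms by (auto simp: top_dual_def)
  from openin_continuous_map_preimage[OF cont, of "{-1<..<1}"]
  have "open {x. \<phi> x \<in> {-1<..<1}}"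
    using openin_imp_open by simp
  moreover have "0 \<in> {x. \<phi> x \<in> {-1<..<1}}" using linear_0[OF lin] by simp
  ultimately obtain e where e: "e > 0" "cball 0 e \<subseteq> {x. \<phi> x \<in> {-1<..<1}}"
    unfolding open_contains_cball by blast
  have "norm (\<phi> x) \<le> norm x * (1 / e)" for x
  proof (cases "x = 0")
    case False
    then have "(e / norm x) *\<^sub>R x \<in> cball 0 e" using e(1) by simp
    then have "\<phi> ((e / norm x) *\<^sub>R x) \<in> {-1<..<1}" using e(2) by blast
    then have "\<bar>(e / norm x) * \<phi> x\<bar> < 1" using linear_scale[OF lin] by auto
    then have "(e / norm x) * \<bar>\<phi> x\<bar> < 1" using e(1) by (simp add: abs_mult)
    then show ?thesis using False e(1) by (simp add: field_simps)
  qed (simp add: linear_0[OF lin])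
  then show ?thesis
    by (intro bounded_linear_intro[where K = "1 / e"]) (simp_all only: linear_add[OF lin] linear_scale[OF lin])
qed

text \<open>The norming property as a rule, with the bound on \<open>onorm\<close> passed on in the
  pointwise form that estimates of integrals use.\<close>

lemma norm_leI:
  assumes "\<And>\<phi>. \<phi> \<in> top_dual \<tau> \<Longrightarrow> (\<And>z. \<bar>\<phi> z\<bar> \<le> norm z) \<Longrightarrow> \<bar>\<phi> x\<bar> \<le> B"
  shows "norm x \<le> B"
  unfolding norming[of x]
proof (rule cSUP_least)
  have "(\<lambda>_. 0) \<in> {\<phi> \<in> top_dual \<tau>. onorm \<phi> \<le> 1}"
    by (simp add: top_dual_def linear_zero onorm_zero)
  then show "{\<phi> \<in> top_dual \<tau>. onorm \<phi> \<le> 1} \<noteq> {}" by blast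
next
  fix \<phi> assume \<phi>: "\<phi> \<in> {\<phi> \<in> top_dual \<tau>. onorm \<phi> \<le> 1}"
  show "\<bar>\<phi> x\<bar> \<le> B"
  proof (rule assms)
    fix z
    have "norm (\<phi> z) \<le> onorm \<phi> * norm z" using \<phi> by (intro onorm bounded_linear_top_dual) auto
    also have "\<dots> \<le> 1 * norm z" using \<phi> by (intro mult_right_mono) auto
    finally show "\<bar>\<phi> z\<bar> \<le> norm z" by simp
  qed (use \<phi> in auto)
qed

text \<open>By the norming property the dual separates points. Hence \<tau>-limits are unique, and
  identities between integrals of orbits reduce to scalar ones.\<close>

lemma eq_by_duality:
  assumes "\<And>\<phi>. \<phi> \<in> top_dual \<tau> \<Longrightarrow> \<phi> x = \<phi> y"
  shows "x = y"
proof -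
  have "norm (x - y) \<le> 0"
  proof (rule norm_leI)
    fix \<phi> assume \<phi>: "\<phi> \<in> top_dual \<tau>"
    then have "\<phi> (x - y) = \<phi> x - \<phi> y" by (intro linear_diff) (simp add: top_dual_def)
    then show "\<bar>\<phi> (x - y)\<bar> \<le> 0" using assms[OF \<phi>] by simp
  qed
  then show ?thesis by simp
qed

lemma tendsto_top_dual:
  assumes "\<phi> \<in> top_dual \<rho>" "limitin \<rho> f l F"
  shows "((\<lambda>x. \<phi> (f x)) \<longlongrightarrow> \<phi> l) F"
  using continuous_map_limit[of \<rho> euclideanreal \<phi> f l F] assms by (simp add: top_dual_def o_def)

lemma limitin_unique:
  assumes "limitin \<tau> f l F" "limitin \<tau> f l' F" "F \<noteq> bot"
  shows "l = l'"
  using assms tendsto_top_dual tendsto_unique by (metis eq_by_duality)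

text \<open>The two topologies agree on a bounded set that contains the limit and, eventually, the
  values. The limit \<open>l\<close> is inserted because no bound on its norm is at hand.\<close>

lemma limitin_mixed:
  assumes l: "limitin \<tau> f l F" and bd: "\<forall>\<^sub>F x in F. norm (f x) \<le> B"
  shows "limitin \<tau>\<^sub>m f l F"
proof -
  let ?B = "insert l (cball 0 B)"
  have "limitin (subtopology \<tau> ?B) f l F"
    unfolding limitin_subtopology using l bd by (auto elim: eventually_mono)
  also have "subtopology \<tau> ?B = subtopology \<tau>\<^sub>m ?B" by (simp add: subtopology_mixed)
  finally show ?thesis by (simp add: limitin_subtopology)
qed

lemma continuous_top_dual_mixed:
  assumes f: "continuous_map (top_of_set S) \<tau> f" and bd: "\<And>s. s \<in> S \<Longrightarrow> norm (f s) \<le> B"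
    and \<phi>: "\<phi> \<in> top_dual \<tau>\<^sub>m"
  shows "continuous_on S (\<lambda>s. \<phi> (f s))"
proof -
  have "continuous_map (top_of_set S) (subtopology \<tau> (cball 0 B)) f"
    using f bd by (auto simp: continuous_map_in_subtopology)
  then have "continuous_map (top_of_set S) \<tau>\<^sub>m f"
    by (simp add: subtopology_mixed[symmetric] continuous_map_in_subtopology)
  moreover have "continuous_map \<tau>\<^sub>m euclideanreal \<phi>" using \<phi> by (simp add: top_dual_def)
  ultimately have "continuous_map (top_of_set S) euclideanreal (\<phi> \<circ> f)"
    by (rule continuous_map_compose)
  then show ?thesis by (simp add: o_def)
qed

text \<open>Riemann sums of two fine divisions are close, so a sequence of divisions with vanishing
  mesh gives a bounded Cauchy sequence, which converges by assumption (i) on \<tau>. The same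
  closeness carries its limit over to all fine divisions.\<close>

lemma has_riemann_integral_exists:
  assumes f: "continuous_map (top_of_set {a..b}) \<tau> f" and ab: "a \<le> b"
    and bd: "\<And>s. s \<in> {a..b} \<Longrightarrow> norm (f s) \<le> B"
  obtains y where "has_riemann_integral \<tau> f a b y"
proof -
  text \<open>A difference of Riemann sums is tested against the functionals \<open>\<phi>\<close> in the polar of a
    neighbourhood: there both sums are close to the integral of \<open>\<phi> \<circ> f\<close>, so no common
    refinement of the two divisions is needed.\<close>
  have close: "\<exists>\<delta>>0. \<forall>p q. p tagged_division_of {a..b} \<and> (\<forall>(s, K)\<in>p. diameter K < \<delta>) \<and>
      q tagged_division_of {a..b} \<and> (\<forall>(s, K)\<in>q. diameter K < \<delta>) \<longrightarrow>
      riemann_sum f p - riemann_sum f q \<in> U" if U: "openin \<tau> U" "0 \<in> U" for U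
  proof -
    obtain V where V: "openin \<tau> V" "0 \<in> V" "convex V" "\<And>x. x \<in> V \<Longrightarrow> - x \<in> V" "V \<subseteq> U"
      using symmetric_convex[OF U] by blast
    \<comment> \<open>With oscillation at most \<open>1 / c\<close>, each sum is within
      \<open>(b - a) / c\<close>, less than \<open>1 / 2\<close>, of the integral; two such errors
      add up to strictly less than 1.\<close>
    define c where "c = 3 * (b - a + 1)"
    have c: "0 < c" using ab by (simp add: c_def)
    obtain \<delta> where \<delta>: "0 < \<delta>"
      "\<And>s t. s \<in> {a..b} \<Longrightarrow> t \<in> {a..b} \<Longrightarrow> \<bar>s - t\<bar> < \<delta> \<Longrightarrow> f s - f t \<in> {x. c *\<^sub>R (x - 0) \<in> V}"
      by (rule uniformly_continuous[OF f openin_affine[OF V(1), of c 0]]) (use V(2) in auto)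
    have "riemann_sum f p - riemann_sum f q \<in> V"
      if p: "p tagged_division_of {a..b}" "\<forall>(s, K)\<in>p. diameter K < \<delta>"
        and q: "q tagged_division_of {a..b}" "\<forall>(s, K)\<in>q. diameter K < \<delta>" for p q
    proof (rule in_nbhd_by_duality[OF V(1-3)])
      fix \<phi> assume \<phi>: "\<phi> \<in> top_dual \<tau>" and le1: "\<And>x. x \<in> V \<Longrightarrow> \<phi> x \<le> 1"
      have lin: "linear \<phi>" using \<phi> by (simp add: top_dual_def)
      define h where "h = (\<lambda>s. \<phi> (f s))"
      have h: "continuous_on {a..b} h"
        using continuous_top_dual_mixed[OF f bd] \<phi> top_dual_subset_mixed unfolding h_def by blast
      have osc: "\<bar>h s - h t\<bar> \<le> 1 / c" if "s \<in> {a..b}" "t \<in> {a..b}" "\<bar>s - t\<bar> < \<delta>" for s t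
      proof -
        have "c *\<^sub>R (f s - f t) \<in> V" using \<delta>(2)[OF that] by simp
        then have "\<phi> (c *\<^sub>R (f s - f t)) \<le> 1" "\<phi> (- (c *\<^sub>R (f s - f t))) \<le> 1"
          using V(4) le1 by blast+
        then have "\<bar>c * (h s - h t)\<bar> \<le> 1"
          unfolding h_def linear_neg[OF lin] linear_scale[OF lin] linear_diff[OF lin] by simp
        then have "c * \<bar>h s - h t\<bar> \<le> 1" using c by (simp add: abs_mult)
        then show ?thesis using c by (simp add: field_simps)
      qed
      have err: "\<bar>riemann_sum h r - integral {a..b} h\<bar> < 1 / 2"
        if r: "r tagged_division_of {a..b}" "\<forall>(s, K)\<in>r. diameter K < \<delta>" for r
      proof -
        have "\<bar>riemann_sum h r - integral {a..b} h\<bar> \<le> 1 / c * (b - a)"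
          by (rule riemann_sum_integral_error[OF h ab osc r(1)]) (use r(2) c in auto)
        also have "\<dots> < 1 / 2" using ab by (simp add: c_def field_simps)
        finally show ?thesis .
      qed
      have "\<phi> (riemann_sum f p - riemann_sum f q) = riemann_sum h p - riemann_sum h q"
        by (simp only: linear_diff[OF lin] linear_riemann_sum[OF lin] h_def)
      also have "\<dots> < 1" using err[OF p] err[OF q] by linarith
      finally show "\<phi> (riemann_sum f p - riemann_sum f q) < 1" .
    qed
    then show ?thesis using \<delta>(1) V(5) by blast
  qed
  obtain P where P: "filterlim P (mesh_filter a b) sequentially" "\<And>n. P n tagged_division_of {a..b}"
    by (rule filterlim_mesh_filter_sequence[of a b]) (rule that)
  have "Cauchy_seq_in \<tau> (\<lambda>n. riemann_sum f (P n))"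
    unfolding Cauchy_seq_in_def
  proof (intro allI impI)
    fix U assume "openin \<tau> U \<and> 0 \<in> U"
    then obtain \<delta> where \<delta>: "0 < \<delta>"
      "\<And>p q. p tagged_division_of {a..b} \<Longrightarrow> (\<forall>(s, K)\<in>p. diameter K < \<delta>) \<Longrightarrow>
        q tagged_division_of {a..b} \<Longrightarrow> (\<forall>(s, K)\<in>q. diameter K < \<delta>) \<Longrightarrow>
        riemann_sum f p - riemann_sum f q \<in> U"
      using close by meson
    have "\<forall>\<^sub>F p in mesh_filter a b. p tagged_division_of {a..b} \<and> (\<forall>(s, K)\<in>p. diameter K < \<delta>)"
      unfolding eventually_mesh_filter using \<delta>(1) by blast
    then have "\<forall>\<^sub>F n in sequentially. P n tagged_division_of {a..b} \<and> (\<forall>(s, K)\<in>P n. diameter K < \<delta>)"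
      using P(1) unfolding filterlim_iff by blast
    then obtain N where N: "\<And>n. n \<ge> N \<Longrightarrow> (\<forall>(s, K)\<in>P n. diameter K < \<delta>)"
      unfolding eventually_sequentially by blast
    have "riemann_sum f (P m) - riemann_sum f (P n) \<in> U" if "m \<ge> N" "n \<ge> N" for m n
      using P(2) N[OF that(1)] P(2) N[OF that(2)] by (rule \<delta>(2))
    then show "\<exists>N. \<forall>m\<ge>N. \<forall>n\<ge>N. riemann_sum f (P m) - riemann_sum f (P n) \<in> U" by blast
  qed
  moreover have "bounded (range (\<lambda>n. riemann_sum f (P n)))"
    using norm_riemann_sum_le[OF P(2) ab, of f B] bd by (auto simp: bounded_iff)
  ultimately obtain y where y: "limitin \<tau> (\<lambda>n. riemann_sum f (P n)) y sequentially"
    using setting unfolding bicontinuous_setting_def by blast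
  have "limitin \<tau> (riemann_sum f) y (mesh_filter a b)"
    unfolding limitin_iff
  proof (intro allI impI)
    fix U assume U: "openin \<tau> U \<and> 0 \<in> U"
    obtain V where V: "openin \<tau> V" "0 \<in> V" "convex V" "\<And>x. x \<in> V \<Longrightarrow> - x \<in> V"
      and sum: "\<And>x y. x \<in> V \<Longrightarrow> y \<in> V \<Longrightarrow> x + y \<in> U"
      using symmetric_convex_half U by blast
    obtain \<delta> where \<delta>: "0 < \<delta>"
      "\<And>p q. p tagged_division_of {a..b} \<Longrightarrow> (\<forall>(s, K)\<in>p. diameter K < \<delta>) \<Longrightarrow>
        q tagged_division_of {a..b} \<Longrightarrow> (\<forall>(s, K)\<in>q. diameter K < \<delta>) \<Longrightarrow>
        riemann_sum f p - riemann_sum f q \<in> V"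
      using close[OF V(1,2)] by meson
    have "\<forall>\<^sub>F p in mesh_filter a b. p tagged_division_of {a..b} \<and> (\<forall>(s, K)\<in>p. diameter K < \<delta>)"
      unfolding eventually_mesh_filter using \<delta>(1) by blast
    then have "\<forall>\<^sub>F n in sequentially. P n tagged_division_of {a..b} \<and> (\<forall>(s, K)\<in>P n. diameter K < \<delta>)"
      using P(1) unfolding filterlim_iff by blast
    moreover have "\<forall>\<^sub>F n in sequentially. riemann_sum f (P n) - y \<in> V"
      using y V unfolding limitin_iff by blast
    ultimately have "\<forall>\<^sub>F n in sequentially. (P n tagged_division_of {a..b} \<and>
        (\<forall>(s, K)\<in>P n. diameter K < \<delta>)) \<and> riemann_sum f (P n) - y \<in> V"
      by (rule eventually_conj)
    \<comment> \<open>A single fine division whose Riemann sum is close to \<open>y\<close> links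
      every other fine division to \<open>y\<close>.\<close>
    then obtain n where n: "\<forall>(s, K)\<in>P n. diameter K < \<delta>" "riemann_sum f (P n) - y \<in> V"
      unfolding eventually_sequentially by blast
    have "riemann_sum f p - y \<in> U"
      if "p tagged_division_of {a..b}" "\<forall>(s, K)\<in>p. diameter K < \<delta>" for p
      using sum[OF \<delta>(2)[OF that P(2) n(1)] n(2)] by simp
    then show "\<forall>\<^sub>F p in mesh_filter a b. riemann_sum f p - y \<in> U"
      unfolding eventually_mesh_filter using \<delta>(1) by blast
  qed
  then show ?thesis using that by (simp add: has_riemann_integral_iff_limitin)
qed

lemma has_riemann_integral_riemann_integral:
  assumes "continuous_map (top_of_set {a..b}) \<tau> f" "a \<le> b"
    and "\<And>s. s \<in> {a..b} \<Longrightarrow> norm (f s) \<le> B"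
  shows "has_riemann_integral \<tau> f a b (riemann_integral \<tau> f a b)"
proof -
  obtain y where "has_riemann_integral \<tau> f a b y"
    using has_riemann_integral_exists[OF assms] .
  moreover from this have "y' = y" if "has_riemann_integral \<tau> f a b y'" for y'
    using that limitin_unique[OF _ _ mesh_filter_neq_bot]
    unfolding has_riemann_integral_iff_limitin by blast
  ultimately show ?thesis unfolding riemann_integral_def by (rule theI)
qed

end

section \<open>Criteria for continuity of functionals in the mixed topology\<close>

context bicontinuous_space
begin

text \<open>The initial topology of \<open>\<tau>\<close> and \<open>\<psi>\<close> agrees with \<open>\<tau>\<close> on bounded sets, so it is coarser
  than \<open>\<tau>\<^sub>m\<close>.\<close>

lemma top_dual_mixedI:
  assumes \<psi>: "linear \<psi>"
    and cont: "\<And>B. bounded B \<Longrightarrow> continuous_map (subtopology \<tau> B) euclideanreal \<psi>"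
  shows "\<psi> \<in> top_dual \<tau>\<^sub>m"
proof -
  \<comment> \<open>The pullback along the graph map is the coarsest topology for which both the
    identity into \<tau> and \<psi> are continuous.\<close>
  define \<rho> where "\<rho> = pullback_topology UNIV (\<lambda>x. (x, \<psi> x)) (prod_topology \<tau> euclideanreal)"
  have top: "topspace \<rho> = UNIV" by (simp add: \<rho>_def topspace_pullback_topology)
  \<comment> \<open>The universal property of the initial topology; it splits each continuity claim
    into \<rho> into one for \<tau> and one for real functions.\<close>
  have into: "continuous_map X \<rho> f \<longleftrightarrow>
      continuous_map X \<tau> f \<and> continuous_map X euclideanreal (\<lambda>x. \<psi> (f x))" for X :: "'b topology" and f
  proof
    assume f: "continuous_map X \<rho> f"
    have "continuous_map \<rho> (prod_topology \<tau> euclideanreal) (id \<circ> (\<lambda>x. (x, \<psi> x)))"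
      unfolding \<rho>_def by (rule continuous_map_pullback) simp
    from continuous_map_compose[OF f this]
    show "continuous_map X \<tau> f \<and> continuous_map X euclideanreal (\<lambda>x. \<psi> (f x))"
      by (simp add: o_def continuous_map_pairwise)
  next
    assume "continuous_map X \<tau> f \<and> continuous_map X euclideanreal (\<lambda>x. \<psi> (f x))"
    then show "continuous_map X \<rho> f"
      unfolding \<rho>_def by (intro continuous_map_pullback') (auto simp: o_def continuous_map_pairwise)
  qed
  have \<rho>\<tau>: "continuous_map \<rho> \<tau> (\<lambda>x. x)" and \<rho>\<psi>: "continuous_map \<rho> euclideanreal \<psi>"
    using into[of \<rho> "\<lambda>x. x"] by simp_all
  have openI: "openin \<rho> {x \<in> A. \<psi> x \<in> W}" if "openin \<tau> A" "open W" for A W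
  proof -
    have "openin \<rho> ({x. x \<in> A} \<inter> {x. \<psi> x \<in> W})"
      using openin_continuous_map_preimage[OF \<rho>\<tau> that(1)]
        openin_continuous_map_preimage[OF \<rho>\<psi>, of W] that(2) top by (intro openin_Int) auto
    then show ?thesis by (simp add: Collect_conj_eq)
  qed
  have "locally_convex_topology \<rho>"
    unfolding locally_convex_topology_def
  proof (intro conjI allI impI)
    show "topspace \<rho> = UNIV" by (rule top)
    have 1: "continuous_map (prod_topology \<rho> \<rho>) \<tau> (\<lambda>z. fst z)" "continuous_map (prod_topology \<rho> \<rho>) \<tau> (\<lambda>z. snd z)"
      "continuous_map (prod_topology \<rho> \<rho>) euclideanreal (\<lambda>z. \<psi> (fst z))"
      "continuous_map (prod_topology \<rho> \<rho>) euclideanreal (\<lambda>z. \<psi> (snd z))"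
      using into[of "prod_topology \<rho> \<rho>" fst] into[of "prod_topology \<rho> \<rho>" snd]
      by (simp_all add: continuous_map_fst continuous_map_snd)
    show "continuous_map (prod_topology \<rho> \<rho>) \<rho> (\<lambda>(x, y). x + y)"
      unfolding into case_prod_unfold linear_add[OF \<psi>]
      using 1 by (intro conjI continuous_map_plus continuous_map_add) auto
    have 2: "continuous_map (prod_topology euclideanreal \<rho>) \<tau> (\<lambda>z. snd z)"
      "continuous_map (prod_topology euclideanreal \<rho>) euclideanreal (\<lambda>z. \<psi> (snd z))"
      "continuous_map (prod_topology euclideanreal \<rho>) euclideanreal (\<lambda>z. fst z)"
      using into[of "prod_topology euclideanreal \<rho>" snd]
      by (simp_all add: continuous_map_fst continuous_map_snd)
    show "continuous_map (prod_topology euclideanreal \<rho>) \<rho> (\<lambda>(c, x). c *\<^sub>R x)"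
      unfolding into case_prod_unfold linear_scale[OF \<psi>] real_scaleR_def
      using 2 by (intro conjI continuous_map_scale continuous_map_real_mult) auto
  next
    fix U assume U: "openin \<rho> U \<and> 0 \<in> U"
    then obtain O' where O': "openin (prod_topology \<tau> euclideanreal) O'" "U = (\<lambda>x. (x, \<psi> x)) -` O'"
      unfolding \<rho>_def openin_pullback_topology by auto
    moreover have "(0, 0) \<in> O'" using U O'(2) linear_0[OF \<psi>] by auto
    ultimately obtain A W where AW: "openin \<tau> A" "open W" "0 \<in> A" "0 \<in> W" "A \<times> W \<subseteq> O'"
      unfolding openin_prod_topology_alt by (metis open_openin)
    obtain V where V: "openin \<tau> V" "0 \<in> V" "convex V" "\<And>x. x \<in> V \<Longrightarrow> - x \<in> V" "V \<subseteq> A"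
      using symmetric_convex[OF AW(1,3)] by blast
    obtain e where e: "0 < e" "ball 0 e \<subseteq> W" using AW(2,4) open_contains_ball by blast
    have "{x \<in> V. \<psi> x \<in> ball 0 e} \<subseteq> U"
      unfolding O'(2) using V(5) e(2) AW(5) by blast
    moreover have "convex {x \<in> V. \<psi> x \<in> ball 0 e}"
    proof -
      have "convex (V \<inter> \<psi> -` ball 0 e)"
        using V(3) convex_linear_vimage[OF \<psi> convex_ball] by (rule convex_Int)
      then show ?thesis by (simp add: vimage_def Int_def)
    qed
    moreover have "openin \<rho> {x \<in> V. \<psi> x \<in> ball 0 e}" using V(1) by (rule openI) simp
    ultimately show "\<exists>V. openin \<rho> V \<and> 0 \<in> V \<and> convex V \<and> V \<subseteq> U"
      using V(2) e(1) linear_0[OF \<psi>] by (intro exI[of _ "{x \<in> V. \<psi> x \<in> ball 0 e}"]) auto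
  qed
  moreover have "agrees_on_bounded \<rho> \<tau>"
    unfolding agrees_on_bounded_def
  proof (intro allI impI)
    fix B :: "'a set" assume B: "bounded B"
    \<comment> \<open>Here the continuity of \<psi> on bounded sets enters: on \<open>B\<close>,
      adjoining \<psi> to \<tau> creates no new open sets.\<close>
    have 1: "continuous_map (subtopology \<tau> B) \<rho> (\<lambda>x. x)"
      unfolding into using cont[OF B] by (simp add: continuous_map_from_subtopology)
    have 2: "continuous_map (subtopology \<rho> B) \<tau> (\<lambda>x. x)"
      using \<rho>\<tau> by (rule continuous_map_from_subtopology)
    have "openin (subtopology \<rho> B) U \<longleftrightarrow> openin (subtopology \<tau> B) U" for U
    proof
      assume "openin (subtopology \<rho> B) U"
      then obtain S where S: "openin \<rho> S" "U = S \<inter> B" by (auto simp: openin_subtopology)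
      have "{x \<in> topspace (subtopology \<tau> B). x \<in> S} = U" using S(2) by auto
      then show "openin (subtopology \<tau> B) U" using openin_continuous_map_preimage[OF 1 S(1)] by simp
    next
      assume "openin (subtopology \<tau> B) U"
      then obtain S where S: "openin \<tau> S" "U = S \<inter> B" by (auto simp: openin_subtopology)
      have "{x \<in> topspace (subtopology \<rho> B). x \<in> S} = U" using S(2) top by auto
      then show "openin (subtopology \<rho> B) U" using openin_continuous_map_preimage[OF 2 S(1)] by simp
    qed
    then show "subtopology \<rho> B = subtopology \<tau> B" by (simp add: topology_eq)
  qed
  ultimately have "openin \<tau>\<^sub>m U" if "openin \<rho> U" for U using mixed_finest that by blast
  then have "continuous_map \<tau>\<^sub>m euclideanreal \<psi>"
    using \<rho>\<psi> top by (auto simp: continuous_map_def)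
  then show ?thesis using \<psi> by (simp add: top_dual_def)
qed

text \<open>Bi-continuity controls sequences only. With a metric for \<tau>, a failure of continuity
  at 0 on a norm ball is witnessed by points in the metric balls of radius
  \<open>1 / (n + 1)\<close>, that is, by a bounded null sequence.\<close>

lemma sequentially_continuous_top_dual_mixed:
  assumes metr: "metrizable_space \<tau>" and \<psi>: "linear \<psi>"
    and seq: "\<And>x B. (\<And>n. norm (x n) \<le> B) \<Longrightarrow> limitin \<tau> x 0 sequentially \<Longrightarrow> (\<lambda>n. \<psi> (x n)) \<longlonglongrightarrow> 0"
  shows "\<psi> \<in> top_dual \<tau>\<^sub>m"
proof (rule top_dual_mixedI[OF \<psi>])
  fix B :: "'a set" assume "bounded B"
  then obtain b where b: "\<And>x. x \<in> B \<Longrightarrow> norm x \<le> b" by (auto simp: bounded_iff)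
  obtain M d where M: "Metric_space M d" "\<tau> = Metric_space.mtopology M d"
    using metr by (auto simp: metrizable_space_def)
  interpret Metric_space M d by (rule M(1))
  have M_UNIV: "x \<in> M" for x using M(2) topspace_eq topspace_mtopology by simp
  \<comment> \<open>Points of \<open>B\<close> are compared through their differences, which have
    norm at most \<open>2 * b\<close>; so continuity at 0 on that ball is enough.\<close>
  have small: "\<exists>V. openin \<tau> V \<and> 0 \<in> V \<and> (\<forall>z\<in>V. norm z \<le> 2 * b \<longrightarrow> \<bar>\<psi> z\<bar> < e)" if e: "0 < e" for e
  proof (rule ccontr)
    assume neg: "\<not> ?thesis"
    have "\<exists>z. d 0 z < inverse (real (Suc n)) \<and> norm z \<le> 2 * b \<and> \<not> \<bar>\<psi> z\<bar> < e" for n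
    proof -
      have "openin \<tau> (mball 0 (inverse (real (Suc n))))" "0 \<in> mball 0 (inverse (real (Suc n)))"
        using M(2) M_UNIV by (simp_all only: openin_mball centre_in_mball_iff) simp
      then obtain z where "z \<in> mball 0 (inverse (real (Suc n)))" "norm z \<le> 2 * b" "\<not> \<bar>\<psi> z\<bar> < e"
        using neg by blast
      then show ?thesis by (auto simp: in_mball)
    qed
    then obtain z where z: "\<And>n. d 0 (z n) < inverse (real (Suc n))" "\<And>n. norm (z n) \<le> 2 * b"
      "\<And>n. \<not> \<bar>\<psi> (z n)\<bar> < e"
      by metis
    have "(\<lambda>n. d (z n) 0) \<longlonglongrightarrow> 0"
      by (rule tendsto_sandwich[OF _ _ tendsto_const LIMSEQ_inverse_real_of_nat])
        (use z(1) in \<open>auto simp: commute intro!: always_eventually less_imp_le\<close>)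
    then have "limitin \<tau> z 0 sequentially"
      using M_UNIV by (simp add: M(2) limitin_metric_dist_null)
    then have "(\<lambda>n. \<psi> (z n)) \<longlonglongrightarrow> 0" using seq z(2) by blast
    then have "\<forall>\<^sub>F n in sequentially. \<bar>\<psi> (z n)\<bar> < e"
      using e by (auto dest!: tendstoD[of _ _ _ e])
    then show False using z(3) by (auto simp: eventually_sequentially)
  qed
  have "openin (subtopology \<tau> B) {x \<in> B. \<psi> x \<in> W}" if W: "open W" for W
  proof (subst openin_subopen, clarify)
    fix x assume x: "x \<in> B" "\<psi> x \<in> W"
    then obtain e where e: "0 < e" "ball (\<psi> x) e \<subseteq> W" using W open_contains_ball by metis
    obtain V where V: "openin \<tau> V" "0 \<in> V" "\<And>z. z \<in> V \<Longrightarrow> norm z \<le> 2 * b \<Longrightarrow> \<bar>\<psi> z\<bar> < e"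
      using small[OF e(1)] by blast
    let ?T = "{y. y - x \<in> V} \<inter> B"
    have "openin (subtopology \<tau> B) ?T"
      using openin_translate[OF V(1)] by (intro openin_subtopology_Int)
    moreover have "\<psi> y \<in> W" if y: "y \<in> ?T" for y
    proof -
      have "norm (y - x) \<le> 2 * b" using norm_triangle_ineq4[of y x] b[of x] b[of y] x y by auto
      then have "\<bar>\<psi> (y - x)\<bar> < e" using V(3) y by auto
      then show ?thesis using e(2) linear_diff[OF \<psi>] by (auto simp: dist_real_def)
    qed
    ultimately show "\<exists>T. openin (subtopology \<tau> B) T \<and> x \<in> T \<and> T \<subseteq> {x \<in> B. \<psi> x \<in> W}"
      using V(2) x by (intro exI[of _ ?T]) auto
  qed
  then show "continuous_map (subtopology \<tau> B) euclideanreal \<psi>"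
    by (auto simp: continuous_map_def)
qed

end

subsection \<open>Integrated orbits and the generator\<close>

lemma riemann_sum_cong:
  assumes "p tagged_division_of S" "\<And>s. s \<in> S \<Longrightarrow> f s = g s"
  shows "riemann_sum f p = riemann_sum g p"
  unfolding riemann_sum_def
  using tagged_division_ofD(2,3)[OF assms(1)] assms(2) by (intro sum.cong) fastforce+

lemma limitin_compose_filterlim:
  "limitin X f l F \<Longrightarrow> filterlim g F G \<Longrightarrow> limitin X (\<lambda>x. f (g x)) l G"
  unfolding limitin_def filterlim_iff by blast

locale bicontinuous_contraction = bicontinuous_space \<tau> \<tau>\<^sub>m
  for \<tau> \<tau>\<^sub>m :: "'a::banach topology" +
  fixes T :: "real \<Rightarrow> 'a \<Rightarrow>\<^sub>L 'a"
  assumes semigroup: "bicontinuous_semigroup \<tau> T" and contraction: "contraction_semigroup T"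
begin

lemma T_0 [simp]: "T 0 x = x"
  using semigroup by (simp add: bicontinuous_semigroup_def)

lemma T_add: "0 \<le> t \<Longrightarrow> 0 \<le> s \<Longrightarrow> T (t + s) x = T t (T s x)"
  using semigroup by (simp add: bicontinuous_semigroup_def)

lemma norm_T_le: "0 \<le> t \<Longrightarrow> norm (T t x) \<le> norm x"
proof -
  assume "0 \<le> t"
  then have "norm (T t x) \<le> 1 * norm x"
    using contraction unfolding contraction_semigroup_def
    by (intro order_trans[OF norm_blinfun] mult_right_mono) auto
  then show ?thesis by simp
qed

lemma continuous_orbit:
  assumes "S \<subseteq> {0..}"
  shows "continuous_map (top_of_set S) \<tau> (\<lambda>t. T t x)"
proof -
  have "continuous_map (top_of_set {0..}) \<tau> (\<lambda>t. T t x)"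
    using semigroup by (simp add: bicontinuous_semigroup_def)
  then have "continuous_map (subtopology (top_of_set {0..}) S) \<tau> (\<lambda>t. T t x)"
    by (rule continuous_map_from_subtopology)
  then show ?thesis using assms by (simp add: subtopology_subtopology Int_absorb1)
qed

lemma T_uniform:
  assumes "\<And>n. norm (x n) \<le> B" "limitin \<tau> x l sequentially" "openin \<tau> U" "0 \<in> U"
  shows "\<exists>N. \<forall>n\<ge>N. \<forall>t\<in>{0..r}. T t (x n) - T t l \<in> U"
proof -
  have "bounded (range x)" using assms(1) by (auto simp: bounded_iff)
  moreover have "is_interval {0..r}" "bounded {0..r}" "{0..r} \<subseteq> {0..}"
    by (auto simp: is_interval_cc)
  ultimately show ?thesis
    using semigroup assms(2-4) unfolding bicontinuous_semigroup_def by meson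
qed

lemma T_limitin:
  assumes "\<And>n. norm (x n) \<le> B" "limitin \<tau> x l sequentially" "0 \<le> t"
  shows "limitin \<tau> (\<lambda>n. T t (x n)) (T t l) sequentially"
  unfolding limitin_iff eventually_sequentially
proof (intro allI impI)
  fix U assume "openin \<tau> U \<and> 0 \<in> U"
  then obtain N where "\<forall>n\<ge>N. \<forall>s\<in>{0..t}. T s (x n) - T s l \<in> U"
    using T_uniform[OF assms(1,2), of U t] by auto
  then show "\<exists>N. \<forall>n\<ge>N. T t (x n) - T t l \<in> U"
    using assms(3) by (intro exI[of _ N]) auto
qed

lemma continuous_dual_orbit:
  assumes "\<phi> \<in> top_dual \<tau>\<^sub>m" "S \<subseteq> {0..}"
  shows "continuous_on S (\<lambda>s. \<phi> (T s x))"
  using assms norm_T_le by (intro continuous_top_dual_mixed[where B = "norm x"] continuous_orbit) auto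

section \<open>Integrals of orbits and their scalar counterparts\<close>

definition J :: "real \<Rightarrow> 'a \<Rightarrow> 'a" where
  "J t x = riemann_integral \<tau> (\<lambda>s. T s x) 0 t"

lemma limitin_J:
  assumes "0 \<le> t"
  shows "limitin \<tau> (riemann_sum (\<lambda>s. T s x)) (J t x) (mesh_filter 0 t)"
  unfolding J_def has_riemann_integral_iff_limitin[symmetric]
  using assms norm_T_le
  by (intro has_riemann_integral_riemann_integral[where B = "norm x"] continuous_orbit) auto

lemma norm_orbit_riemann_sum_le:
  assumes "p tagged_division_of {0..t}" "0 \<le> t"
  shows "norm (riemann_sum (\<lambda>s. T s x) p) \<le> norm x * t"
  using norm_riemann_sum_le[of p 0 t "\<lambda>s. T s x" "norm x"] assms norm_T_le by simp

text \<open>The Riemann sums are bounded by \<open>norm x * t\<close>, so their \<tau>-limit is also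
  a \<open>\<tau>\<^sub>m\<close>-limit. This is why the formula is available for the larger
  dual.\<close>

lemma dual_J:
  assumes \<phi>: "\<phi> \<in> top_dual \<tau>\<^sub>m" and t: "0 \<le> t"
  shows "\<phi> (J t x) = integral {0..t} (\<lambda>s. \<phi> (T s x))"
proof -
  have lin: "linear \<phi>" using \<phi> by (simp add: top_dual_def)
  have "\<forall>\<^sub>F p in mesh_filter 0 t. norm (riemann_sum (\<lambda>s. T s x) p) \<le> norm x * t"
    using eventually_tagged_division by eventually_elim (rule norm_orbit_riemann_sum_le[OF _ t])
  from tendsto_top_dual[OF \<phi> limitin_mixed[OF limitin_J[OF t] this]]
  have "(riemann_sum (\<lambda>s. \<phi> (T s x)) \<longlongrightarrow> \<phi> (J t x)) (mesh_filter 0 t)"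
    by (simp only: linear_riemann_sum[OF lin])
  moreover have "(riemann_sum (\<lambda>s. \<phi> (T s x)) \<longlongrightarrow> integral {0..t} (\<lambda>s. \<phi> (T s x))) (mesh_filter 0 t)"
    using \<phi> t by (intro tendsto_riemann_sum continuous_dual_orbit) auto
  ultimately show ?thesis using mesh_filter_neq_bot tendsto_unique by blast
qed

text \<open>The functional \<open>\<phi> \<circ> T h\<close> is not known to be
  \<open>\<tau>\<^sub>m\<close>-continuous here, so \<open>dual_J\<close> does not apply to it.
  Instead \<open>T h\<close> is moved inside a bounded convergent sequence of Riemann sums, and the
  semigroup law shifts the interval by \<open>h\<close>.\<close>

lemma dual_T_J:
  assumes \<phi>: "\<phi> \<in> top_dual \<tau>" and t: "0 \<le> t" and h: "0 \<le> h"
  shows "\<phi> (T h (J t x)) = integral {h..t + h} (\<lambda>s. \<phi> (T s x))"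
proof -
  have lin: "linear (\<lambda>y. \<phi> (T h y))"
    using \<phi> linear_compose[of "T h" \<phi>]
    by (simp add: top_dual_def o_def blinfun.bounded_linear_right bounded_linear.linear)
  have \<phi>m: "\<phi> \<in> top_dual \<tau>\<^sub>m" using \<phi> top_dual_subset_mixed by blast
  obtain P where P: "filterlim P (mesh_filter 0 t) sequentially" "\<And>n. P n tagged_division_of {0..t}"
    by (rule filterlim_mesh_filter_sequence[of 0 t]) (rule that)
  let ?S = "\<lambda>n. riemann_sum (\<lambda>s. T s x) (P n)"
  have "limitin \<tau> ?S (J t x) sequentially"
    using limitin_J[OF t] P(1) by (rule limitin_compose_filterlim)
  then have "limitin \<tau> (\<lambda>n. T h (?S n)) (T h (J t x)) sequentially"
    using norm_orbit_riemann_sum_le[OF P(2) t] h by (intro T_limitin)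
  from tendsto_top_dual[OF \<phi> this]
  have "(\<lambda>n. riemann_sum (\<lambda>s. \<phi> (T h (T s x))) (P n)) \<longlonglongrightarrow> \<phi> (T h (J t x))"
    by (simp only: linear_riemann_sum[OF lin])
  moreover have "riemann_sum (\<lambda>s. \<phi> (T h (T s x))) (P n) = riemann_sum (\<lambda>s. \<phi> (T (s + h) x)) (P n)" for n
    using h T_add[of h] by (intro riemann_sum_cong[OF P(2)]) (auto simp: add.commute)
  ultimately have "(\<lambda>n. riemann_sum (\<lambda>s. \<phi> (T (s + h) x)) (P n)) \<longlonglongrightarrow> \<phi> (T h (J t x))"
    by simp
  moreover have "continuous_on {0..t} (\<lambda>s. \<phi> (T (s + h) x))"
    by (rule continuous_on_compose2[OF continuous_dual_orbit[OF \<phi>m order_refl]])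
      (use h in \<open>auto intro!: continuous_intros\<close>)
  then have "(\<lambda>n. riemann_sum (\<lambda>s. \<phi> (T (s + h) x)) (P n)) \<longlonglongrightarrow> integral {0..t} (\<lambda>s. \<phi> (T (s + h) x))"
    using tendsto_riemann_sum t filterlim_compose P(1) by blast
  ultimately have "\<phi> (T h (J t x)) = integral {0..t} (\<lambda>s. \<phi> (T (s + h) x))"
    by (rule LIMSEQ_unique)
  also have "\<dots> = integral {0 + h..t + h} (\<lambda>s. \<phi> (T s x))"
    using integral_shift[of 0 h t "\<lambda>s. \<phi> (T s x)"] h
    by (simp add: o_def continuous_dual_orbit[OF \<phi>m])
  finally show ?thesis by simp
qed

text \<open>Tested against \<phi>, both sides are differences of integrals of one function over
  subintervals of \<open>{0..t + h}\<close>. Splitting that interval at \<open>h\<close> and at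
  \<open>t\<close> gives the equality.\<close>

lemma T_J_commute:
  assumes t: "0 \<le> t" and h: "0 \<le> h"
  shows "T h (J t x) - J t x = T t (J h x) - J h x"
proof (rule eq_by_duality)
  fix \<phi> assume \<phi>: "\<phi> \<in> top_dual \<tau>"
  then have \<phi>m: "\<phi> \<in> top_dual \<tau>\<^sub>m" and lin: "linear \<phi>"
    using top_dual_subset_mixed by (auto simp: top_dual_def)
  let ?g = "\<lambda>s. \<phi> (T s x)"
  have "?g integrable_on {0..t + h}"
    using continuous_dual_orbit[OF \<phi>m] by (intro integrable_continuous_interval) auto
  then have "integral {0..h} ?g + integral {h..t + h} ?g = integral {0..t + h} ?g"
    "integral {0..t} ?g + integral {t..t + h} ?g = integral {0..t + h} ?g"
    using t h by (auto intro!: Henstock_Kurzweil_Integration.integral_combine)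
  moreover have "\<phi> (J t x) = integral {0..t} ?g" "\<phi> (J h x) = integral {0..h} ?g"
    "\<phi> (T h (J t x)) = integral {h..t + h} ?g" "\<phi> (T t (J h x)) = integral {t..t + h} ?g"
    using dual_J[OF \<phi>m] dual_T_J[OF \<phi>, of t h x] dual_T_J[OF \<phi>, of h t x] t h
    by (simp_all add: add.commute)
  ultimately show "\<phi> (T h (J t x) - J t x) = \<phi> (T t (J h x) - J h x)"
    by (simp add: linear_diff[OF lin])
qed

lemma norm_J_le:
  assumes t: "0 \<le> t"
  shows "norm (J t x) \<le> norm x * t"
proof (rule norm_leI)
  fix \<phi> assume \<phi>: "\<phi> \<in> top_dual \<tau>" and le: "\<And>z. \<bar>\<phi> z\<bar> \<le> norm z"
  have \<phi>m: "\<phi> \<in> top_dual \<tau>\<^sub>m" using \<phi> top_dual_subset_mixed by blast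
  have "norm (integral {0..t} (\<lambda>s. \<phi> (T s x))) \<le> norm x * (t - 0)"
  proof (rule integral_bound)
    fix s assume "s \<in> {0..t}"
    then show "norm (\<phi> (T s x)) \<le> norm x" using le[of "T s x"] norm_T_le[of s x] by simp
  qed (use t continuous_dual_orbit[OF \<phi>m] in auto)
  then show "\<bar>\<phi> (J t x)\<bar> \<le> norm x * t" using dual_J[OF \<phi>m t] by simp
qed

lemma norm_J_average_le: "0 < t \<Longrightarrow> norm (J t x /\<^sub>R t) \<le> norm x"
  using norm_J_le[of t x] by (simp add: field_simps)

text \<open>For small \<open>h\<close> the orbit on \<open>{0..h}\<close> stays in
  \<open>x + V / 2\<close>. A functional at most 1 on \<open>V\<close> then exceeds
  \<open>\<phi> x\<close> by at most \<open>1 / 2\<close> there, and so does its average.\<close>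

lemma limitin_J_average: "limitin \<tau> (\<lambda>h. J h x /\<^sub>R h) x (at_right 0)"
  unfolding limitin_iff
proof (intro allI impI)
  fix U assume U: "openin \<tau> U \<and> 0 \<in> U"
  obtain V where V: "openin \<tau> V" "0 \<in> V" "convex V" "\<And>x. x \<in> V \<Longrightarrow> - x \<in> V" "V \<subseteq> U"
    using symmetric_convex U by blast
  obtain \<delta> where \<delta>: "0 < \<delta>" "\<And>s t. s \<in> {0..1} \<Longrightarrow> t \<in> {0..1} \<Longrightarrow> \<bar>s - t\<bar> < \<delta> \<Longrightarrow>
      T s x - T t x \<in> {x. 2 *\<^sub>R (x - 0) \<in> V}"
  proof (rule uniformly_continuous[of 0 1 "\<lambda>s. T s x" "{x. 2 *\<^sub>R (x - 0) \<in> V}"])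
    show "continuous_map (top_of_set {0..1}) \<tau> (\<lambda>s. T s x)" by (rule continuous_orbit) auto
    show "openin \<tau> {x. 2 *\<^sub>R (x - 0) \<in> V}" by (rule openin_affine[OF V(1)])
  qed (use V(2) that in auto)
  have "J h x /\<^sub>R h - x \<in> V" if h: "0 < h" "h < min \<delta> 1" for h
  proof (rule in_nbhd_by_duality[OF V(1-3)])
    fix \<phi> assume \<phi>: "\<phi> \<in> top_dual \<tau>" and le1: "\<And>x. x \<in> V \<Longrightarrow> \<phi> x \<le> 1"
    then have \<phi>m: "\<phi> \<in> top_dual \<tau>\<^sub>m" and lin: "linear \<phi>"
      using top_dual_subset_mixed by (auto simp: top_dual_def)
    have "integral {0..h} (\<lambda>s. \<phi> (T s x)) \<le> integral {0..h} (\<lambda>s. \<phi> x + 1 / 2)"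
    proof (rule integral_le)
      fix s assume "s \<in> {0..h}"
      then have "2 *\<^sub>R (T s x - x) \<in> V" using \<delta>(2)[of s 0] h by auto
      from le1[OF this] show "\<phi> (T s x) \<le> \<phi> x + 1 / 2"
        unfolding linear_scale[OF lin] linear_diff[OF lin] by simp
    qed (use continuous_dual_orbit[OF \<phi>m] in \<open>auto intro!: integrable_continuous_interval\<close>)
    also have "\<dots> = h * (\<phi> x + 1 / 2)" using h by simp
    finally have "integral {0..h} (\<lambda>s. \<phi> (T s x)) / h \<le> \<phi> x + 1 / 2"
      using h by (simp add: field_simps)
    moreover have "\<phi> (J h x /\<^sub>R h) = integral {0..h} (\<lambda>s. \<phi> (T s x)) / h"
      using h by (simp only: linear_scale[OF lin] dual_J[OF \<phi>m less_imp_le]) (simp add: divide_inverse mult.commute)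
    ultimately have "\<phi> (J h x /\<^sub>R h) \<le> \<phi> x + 1 / 2" by simp
    then show "\<phi> (J h x /\<^sub>R h - x) < 1" unfolding linear_diff[OF lin] by simp
  qed
  then show "\<forall>\<^sub>F h in at_right 0. J h x /\<^sub>R h - x \<in> U"
    using \<delta>(1) V(5) by (intro eventually_at_rightI[of 0 "min \<delta> 1"]) auto
qed

lemma generator_eq:
  assumes "limitin \<tau> (\<lambda>t. (T t x - x) /\<^sub>R t) y (at_right 0)"
  shows "generator \<tau> T x = y"
  unfolding generator_def
  by (rule the_equality, rule assms) (rule limitin_unique[OF _ assms trivial_limit_at_right_real])

text \<open>By \<open>T_J_commute\<close> the difference quotient of \<open>J t x\<close> is
  \<open>T t (a h) - a h\<close> with the averages \<open>a h\<close> of the orbit. These are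
  bounded by \<open>norm x\<close> and tend to \<open>x\<close>, and \<open>T t\<close> preserves
  such limits.\<close>

lemma J_in_generator_domain:
  assumes t: "0 \<le> t"
  shows "J t x \<in> generator_domain \<tau> T" and "generator \<tau> T (J t x) = T t x - x"
proof -
  define a where "a h = J h x /\<^sub>R h" for h
  have quot: "(T h (J t x) - J t x) /\<^sub>R h = T t (a h) - a h" if "0 < h" for h
    using T_J_commute[OF t, of h x] that
    by (simp add: a_def blinfun.scaleR_right scaleR_diff_right)
  have a: "norm (a h) \<le> norm x" if "0 < h" for h
    using norm_J_average_le that by (simp add: a_def)
  have "limitin \<tau> (\<lambda>h. T t (a h)) (T t x) (at_right 0)"
    unfolding limitin_iff
  proof (intro allI impI)
    fix U assume U: "openin \<tau> U \<and> 0 \<in> U"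
    show "\<forall>\<^sub>F h in at_right 0. T t (a h) - T t x \<in> U"
    \<comment> \<open>\<open>T_limitin\<close> speaks of sequences, so the limit from the right is
      checked along null sequences of positive times.\<close>
    proof (rule sequentially_imp_eventually_at_right[of 0 1])
      fix f :: "nat \<Rightarrow> real"
      assume f: "\<And>n. 0 < f n" "f \<longlonglongrightarrow> 0"
      then have "filterlim f (at_right 0) sequentially"
        by (simp add: filterlim_at less_imp_neq[symmetric])
      then have "limitin \<tau> (\<lambda>n. a (f n)) x sequentially"
        unfolding a_def by (rule limitin_compose_filterlim[OF limitin_J_average])
      then have "limitin \<tau> (\<lambda>n. T t (a (f n))) (T t x) sequentially"
        by (rule T_limitin[OF a[OF f(1)] _ t])
      then show "\<forall>\<^sub>F n in sequentially. T t (a (f n)) - T t x \<in> U"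
        using U unfolding limitin_iff by blast
    qed simp
  qed
  then have "limitin \<tau> (\<lambda>h. T t (a h) - a h) (T t x - x) (at_right 0)"
    using limitin_J_average unfolding a_def by (intro limitin_diff)
  then have lim: "limitin \<tau> (\<lambda>h. (T h (J t x) - J t x) /\<^sub>R h) (T t x - x) (at_right 0)"
    by (rule limitin_transform_eventually[rotated])
      (use quot in \<open>auto intro!: eventually_at_rightI[of 0 1]\<close>)
  then show "generator \<tau> T (J t x) = T t x - x" by (rule generator_eq)
  have "norm (T t (a h) - a h) \<le> 2 * norm x" if "0 < h" for h
    using norm_triangle_ineq4[of "T t (a h)" "a h"] norm_T_le[OF t, of "a h"] a[OF that] by linarith
  then have "bdd_above ((\<lambda>h. norm ((T h (J t x) - J t x) /\<^sub>R h)) ` {0<..<1})"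
    using quot by (intro bdd_aboveI[of _ "2 * norm x"]) auto
  then show "J t x \<in> generator_domain \<tau> T" using lim by (auto simp: generator_domain_def)
qed

end

subsection \<open>Cesaro means and fixed spaces\<close>

lemma weak_topology_eventually:
  assumes "openin (weak_topology F) U" "y \<in> U"
    and lim: "\<And>\<phi>. \<phi> \<in> F \<Longrightarrow> ((\<lambda>n. \<phi> (x n)) \<longlongrightarrow> \<phi> y) G"
  shows "\<forall>\<^sub>F n in G. x n \<in> U"
proof -
  have "generate_topology_on {\<phi> -` U | \<phi> U. \<phi> \<in> F \<and> open U} U"
    using assms(1) unfolding weak_topology_def openin_topology_generated_by_iff .
  then show ?thesis using \<open>y \<in> U\<close>
  proof induction
    case (Int a b)
    then show ?case by (simp add: eventually_conj)
  next
    case (UN K)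
    then obtain k where "k \<in> K" "y \<in> k" by auto
    then have "\<forall>\<^sub>F n in G. x n \<in> k" using UN.IH by blast
    then show ?case by eventually_elim (use \<open>k \<in> K\<close> in auto)
  next
    case (Basis s)
    then obtain \<phi> W where s: "s = \<phi> -` W" "\<phi> \<in> F" "open W" by auto
    then have "\<forall>\<^sub>F n in G. \<phi> (x n) \<in> W"
      using topological_tendstoD[OF lim] Basis.prems by auto
    then show ?case using s(1) by simp
  qed simp
qed

lemma weak_accumulation_pointI:
  assumes "F \<noteq> {}" and "\<And>\<phi>. \<phi> \<in> F \<Longrightarrow> (\<lambda>n. \<phi> (x n)) \<longlonglongrightarrow> \<phi> y"
  shows "accumulation_point_in (weak_topology F) x y"
  unfolding accumulation_point_in_def
proof (intro conjI allI impI)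
  \<comment> \<open>A nonempty \<open>F\<close> matters: the topology generated by the empty family
    has empty carrier and thus no accumulation points.\<close>
  obtain \<phi> where "\<phi> \<in> F" using assms(1) by auto
  then have "\<phi> -` UNIV \<in> {\<phi> -` U | \<phi> U. \<phi> \<in> F \<and> open U}" by blast
  then show "y \<in> topspace (weak_topology F)"
    unfolding weak_topology_def topology_generated_by_topspace by blast
next
  fix U assume "openin (weak_topology F) U \<and> y \<in> U"
  then have "\<forall>\<^sub>F n in sequentially. x n \<in> U"
    using assms(2) by (intro weak_topology_eventually[of F U y]) auto
  then show "\<exists>\<^sub>F n in sequentially. x n \<in> U"
    by (intro eventually_frequently) auto
qed

lemma weak_accumulation_pointD:
  assumes "accumulation_point_in (weak_topology F) x y" "\<phi> \<in> F" "open W" "\<phi> y \<in> W"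
  shows "\<exists>\<^sub>F n in sequentially. \<phi> (x n) \<in> W"
proof -
  have "openin (weak_topology F) (\<phi> -` W)"
    unfolding weak_topology_def using assms(2,3) by (intro topology_generated_by_Basis) blast
  then show ?thesis
    using assms(1,4) unfolding accumulation_point_in_def by fastforce
qed

section \<open>The implications between the ergodic properties\<close>

context bicontinuous_contraction
begin

lemma cesaro_mean_eq: "cesaro_mean \<tau> T r x = J r x /\<^sub>R r"
  by (simp add: cesaro_mean_def J_def inverse_eq_divide)

text \<open>Contractivity bounds the Cesaro means by \<open>norm x\<close>, so \<tau>-convergence is
  \<open>\<tau>\<^sub>m\<close>-convergence, which functionals in
  \<open>top_dual \<tau>\<^sub>m\<close> preserve.\<close>

lemma mean_ergodic_imp_weakly_convergent:
  assumes "mean_ergodic \<tau> T"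
  shows "cesaro_weakly_convergent \<tau> \<tau>\<^sub>m T"
  unfolding cesaro_weakly_convergent_def
proof
  fix x
  obtain y where y: "limitin \<tau> (\<lambda>r. cesaro_mean \<tau> T r x) y at_top"
    using assms by (auto simp: mean_ergodic_def)
  have "\<forall>\<^sub>F r in at_top. norm (cesaro_mean \<tau> T r x) \<le> norm x"
    using eventually_gt_at_top[of 0]
    by eventually_elim (simp only: cesaro_mean_eq norm_J_average_le)
  with y have "limitin \<tau>\<^sub>m (\<lambda>r. cesaro_mean \<tau> T r x) y at_top" by (rule limitin_mixed)
  then show "\<exists>y. \<forall>\<phi>\<in>top_dual \<tau>\<^sub>m. ((\<lambda>r. \<phi> (cesaro_mean \<tau> T r x)) \<longlongrightarrow> \<phi> y) at_top"
    using tendsto_top_dual by blast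
qed

lemma weakly_convergent_imp_weakly_accumulating:
  assumes "cesaro_weakly_convergent \<tau> \<tau>\<^sub>m T"
  shows "cesaro_weakly_accumulating \<tau> \<tau>\<^sub>m T"
  unfolding cesaro_weakly_accumulating_def
proof
  fix x
  obtain y where y: "\<And>\<phi>. \<phi> \<in> top_dual \<tau>\<^sub>m \<Longrightarrow> ((\<lambda>r. \<phi> (cesaro_mean \<tau> T r x)) \<longlongrightarrow> \<phi> y) at_top"
    using assms unfolding cesaro_weakly_convergent_def by blast
  \<comment> \<open>The shift by one keeps all times positive.\<close>
  define r where "r n = real (Suc n)" for n
  have r: "filterlim r at_top sequentially"
    unfolding r_def using filterlim_real_sequentially filterlim_sequentially_Suc by blast
  have "(\<lambda>_. 0) \<in> top_dual \<tau>\<^sub>m" by (simp add: top_dual_def linear_zero)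
  then have "accumulation_point_in (weak_topology (top_dual \<tau>\<^sub>m)) (\<lambda>n. cesaro_mean \<tau> T (r n) x) y"
    using filterlim_compose[OF y r] by (intro weak_accumulation_pointI) auto
  then show "\<exists>r. (\<forall>n. r n > 0) \<and> filterlim r at_top sequentially \<and>
      (\<exists>y. accumulation_point_in (weak_topology (top_dual \<tau>\<^sub>m)) (\<lambda>n. cesaro_mean \<tau> T (r n) x) y)"
    using r by (intro exI[of _ r]) (auto simp: r_def)
qed

text \<open>The difference \<theta> of two invariant functionals is constant on each orbit, hence on
  its closed convex hull. A fixed point in the hull of a point where \<theta> does not vanish
  therefore tells the two apart.\<close>

lemma orbit_hulls_imp_separates:
  assumes "orbit_hulls_meet_fixed_space \<tau>\<^sub>m T"
  shows "separates (fixed_space T) (dual_fixed_space (top_dual \<tau>\<^sub>m) T)"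
  unfolding separates_def
proof (intro ballI impI)
  fix \<phi> \<psi> assume \<phi>: "\<phi> \<in> dual_fixed_space (top_dual \<tau>\<^sub>m) T"
    and \<psi>: "\<psi> \<in> dual_fixed_space (top_dual \<tau>\<^sub>m) T" and "\<phi> \<noteq> \<psi>"
  then obtain x where x: "\<phi> x \<noteq> \<psi> x" by auto
  define \<theta> where "\<theta> z = \<phi> z - \<psi> z" for z
  have lin: "linear \<theta>" and cont: "continuous_map \<tau>\<^sub>m euclideanreal \<theta>"
    using \<phi> \<psi> unfolding \<theta>_def
    by (auto simp: dual_fixed_space_def top_dual_def
        intro: linear_compose_sub continuous_map_diff)
  let ?H = "{z. \<theta> z = \<theta> x}"
  have "\<theta> (T t x) = \<theta> x" if "0 \<le> t" for t
    using \<phi> \<psi> that by (auto simp: \<theta>_def dual_fixed_space_def dual_map_def fun_eq_iff)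
  moreover have "convex ?H"
    using convex_linear_vimage[OF lin, of "{\<theta> x}"] by (simp add: vimage_def)
  ultimately have "convex hull ((\<lambda>t. T t x) ` {0..}) \<subseteq> ?H"
    by (intro hull_minimal) auto
  moreover have "closedin \<tau>\<^sub>m ?H"
    using closedin_continuous_map_preimage[OF cont, of "{\<theta> x}"] by simp
  ultimately have "\<tau>\<^sub>m closure_of (convex hull ((\<lambda>t. T t x) ` {0..})) \<subseteq> ?H"
    by (rule closure_of_minimal)
  then obtain z where "z \<in> fixed_space T" "\<theta> z = \<theta> x"
    using assms unfolding orbit_hulls_meet_fixed_space_def by blast
  moreover from this(2) x have "\<phi> z \<noteq> \<psi> z" by (auto simp: \<theta>_def)
  ultimately show "\<exists>x\<in>fixed_space T. \<phi> x \<noteq> \<psi> x" by blast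
qed

text \<open>The functional \<open>\<phi> \<circ> T t - \<phi>\<close> tends to 0 along the Cesaro
  means. Metrizability makes it \<open>\<tau>\<^sub>m\<close>-continuous, so its value at a weak
  accumulation point is 0 as well.\<close>

lemma weak_accumulation_point_fixed:
  assumes metr: "metrizable_space \<tau>"
    and r: "\<And>n. r n > 0" "filterlim r at_top sequentially"
    and y: "accumulation_point_in (weak_topology (top_dual \<tau>\<^sub>m)) (\<lambda>n. cesaro_mean \<tau> T (r n) x) y"
  shows "y \<in> fixed_space T"
  unfolding fixed_space_def
proof (clarify, rule eq_by_duality)
  fix t :: real and \<phi> assume t: "0 \<le> t" and \<phi>: "\<phi> \<in> top_dual \<tau>"
  interpret \<phi>: bounded_linear \<phi> using \<phi> by (rule bounded_linear_top_dual)
  define \<psi> where "\<psi> z = \<phi> (T t z) - \<phi> z" for z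
  have \<psi>: "\<psi> \<in> top_dual \<tau>\<^sub>m"
  proof (rule sequentially_continuous_top_dual_mixed[OF metr])
    show "linear \<psi>"
      by (rule linearI) (simp_all add: \<psi>_def blinfun.add_right blinfun.scaleR_right \<phi>.add \<phi>.scaleR algebra_simps)
    fix z :: "nat \<Rightarrow> 'a" and B assume "\<And>n. norm (z n) \<le> B" and z: "limitin \<tau> z 0 sequentially"
    then have "limitin \<tau> (\<lambda>n. T t (z n)) (T t 0) sequentially" using t by (intro T_limitin)
    from tendsto_diff[OF tendsto_top_dual[OF \<phi> this] tendsto_top_dual[OF \<phi> z]]
    show "(\<lambda>n. \<psi> (z n)) \<longlonglongrightarrow> 0" by (simp add: \<psi>_def \<phi>.zero)
  qed
  obtain K where K: "\<And>z. norm (\<phi> z) \<le> norm z * K" "0 \<le> K" using \<phi>.nonneg_bounded by blast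
  \<comment> \<open>\<open>T_J_commute\<close> exchanges the roles of the times: the increment of
    \<open>J s x\<close> under \<open>T t\<close> is that of \<open>J t x\<close> under
    \<open>T s\<close>, bounded by \<open>2 * norm (J t x)\<close> for every \<open>s\<close>.
    Division by \<open>s\<close> makes it vanish.\<close>
  have bound: "\<bar>\<psi> (cesaro_mean \<tau> T s x)\<bar> \<le> (2 * norm (J t x) * K) / s" if s: "0 < s" for s
  proof -
    have "\<psi> (cesaro_mean \<tau> T s x) = \<phi> (T s (J t x) - J t x) / s"
      using T_J_commute[of s t x] s t
      by (simp add: \<psi>_def cesaro_mean_eq blinfun.scaleR_right \<phi>.scaleR \<phi>.diff[symmetric]
          divide_inverse_commute right_diff_distrib[symmetric])
    moreover have "\<bar>\<phi> (T s (J t x) - J t x)\<bar> \<le> 2 * norm (J t x) * K"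
    proof -
      have "norm (T s (J t x) - J t x) \<le> 2 * norm (J t x)"
        using norm_triangle_ineq4[of "T s (J t x)" "J t x"] norm_T_le[of s "J t x"] s by linarith
      then show ?thesis
        using K(1)[of "T s (J t x) - J t x"] mult_right_mono[OF _ K(2)] by fastforce
    qed
    ultimately show ?thesis using s by (simp add: divide_right_mono)
  qed
  have "(\<lambda>n. (2 * norm (J t x) * K) / r n) \<longlonglongrightarrow> 0"
    using r(2) by (intro tendsto_divide_0[OF tendsto_const] filterlim_at_top_imp_at_infinity)
  then have lim: "(\<lambda>n. \<psi> (cesaro_mean \<tau> T (r n) x)) \<longlonglongrightarrow> 0"
    by (rule Lim_null_comparison[rotated]) (use bound r(1) in auto)
  have "\<psi> y = 0"
  proof (rule ccontr)
    assume "\<psi> y \<noteq> 0"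
    then have e: "0 < \<bar>\<psi> y\<bar> / 2" by simp
    have "\<exists>\<^sub>F n in sequentially. \<psi> (cesaro_mean \<tau> T (r n) x) \<in> ball (\<psi> y) (\<bar>\<psi> y\<bar> / 2)"
      by (rule weak_accumulation_pointD[OF y \<psi>]) (use e in auto)
    moreover have "\<forall>\<^sub>F n in sequentially. \<psi> (cesaro_mean \<tau> T (r n) x) \<notin> ball (\<psi> y) (\<bar>\<psi> y\<bar> / 2)"
      using tendstoD[OF lim e]
    proof eventually_elim
      case (elim n)
      then show ?case unfolding mem_ball dist_real_def by linarith
    qed
    ultimately show False by (simp add: frequently_def)
  qed
  then show "\<phi> (T t y) = \<phi> y" by (simp add: \<psi>_def)
qed

text \<open>Otherwise a functional separates \<open>y\<close> from the orbit with gap 1. Averaging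
  preserves the gap for all Cesaro means, which contradicts their values coming close to
  \<open>f y\<close> infinitely often.\<close>

lemma weak_accumulation_point_in_closure:
  assumes r: "\<And>n. r n > 0"
    and y: "accumulation_point_in (weak_topology (top_dual \<tau>\<^sub>m)) (\<lambda>n. cesaro_mean \<tau> T (r n) x) y"
  shows "y \<in> \<tau>\<^sub>m closure_of (convex hull ((\<lambda>t. T t x) ` {0..}))" (is "_ \<in> _ closure_of ?C")
proof (rule ccontr)
  assume "y \<notin> \<tau>\<^sub>m closure_of ?C"
  then obtain U where U: "openin \<tau>\<^sub>m U" "y \<in> U" "U \<inter> ?C = {}"
    unfolding in_closure_of by auto
  have "openin \<tau>\<^sub>m {z. z - (- y) \<in> U}" using U(1) by (rule m.openin_translate)
  then obtain V where V: "openin \<tau>\<^sub>m V" "0 \<in> V" "convex V" "\<And>x. x \<in> V \<Longrightarrow> - x \<in> V"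
    "V \<subseteq> {z. z - (- y) \<in> U}"
    by (rule m.symmetric_convex) (use U(2) that in auto)
  \<comment> \<open>The hull is translated by \<open>- y\<close> because separation is available for
    neighbourhoods of 0.\<close>
  let ?S = "(\<lambda>c. c - y) ` ?C"
  have "convex ?S" "?S \<noteq> {}" by (auto simp: convex_translation_subtract)
  moreover have "?S \<inter> V = {}" using U(3) V(5) by auto
  ultimately obtain f where f: "f \<in> top_dual \<tau>\<^sub>m" "\<And>s. s \<in> ?S \<Longrightarrow> 1 \<le> f s"
    using m.separation[OF V(1-3)] by metis
  have lin: "linear f" using f(1) by (simp add: top_dual_def)
  have ge: "f y + 1 \<le> f (cesaro_mean \<tau> T s x)" if s: "0 < s" for s
  proof -
    have "integral {0..s} (\<lambda>t. f y + 1) \<le> integral {0..s} (\<lambda>t. f (T t x))"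
    proof (rule integral_le)
      fix t assume "t \<in> {0..s}"
      then have "T t x \<in> ?C" by (intro hull_inc) auto
      then have "1 \<le> f (T t x - y)" by (intro f(2) imageI)
      then show "f y + 1 \<le> f (T t x)" by (simp add: linear_diff[OF lin])
    qed (use continuous_dual_orbit[OF f(1)] in \<open>auto intro!: integrable_continuous_interval\<close>)
    then have "s * (f y + 1) \<le> f (J s x)" using dual_J[OF f(1), of s x] s by simp
    then show ?thesis
      using s by (simp add: cesaro_mean_eq linear_scale[OF lin] field_simps)
  qed
  have "\<exists>\<^sub>F n in sequentially. f (cesaro_mean \<tau> T (r n) x) \<in> {..<f y + 1}"
    by (rule weak_accumulation_pointD[OF y f(1)]) auto
  then have "\<exists>\<^sub>F n in sequentially. False"
    by (rule frequently_elim1) (use ge r in \<open>auto simp: not_less[symmetric]\<close>)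
  then show False by simp
qed

lemma weakly_accumulating_imp_orbit_hulls:
  assumes "metrizable_space \<tau>" "cesaro_weakly_accumulating \<tau> \<tau>\<^sub>m T"
  shows "orbit_hulls_meet_fixed_space \<tau>\<^sub>m T"
  unfolding orbit_hulls_meet_fixed_space_def
proof
  fix x
  obtain r y where "\<And>n. r n > 0" "filterlim r at_top sequentially"
    "accumulation_point_in (weak_topology (top_dual \<tau>\<^sub>m)) (\<lambda>n. cesaro_mean \<tau> T (r n) x) y"
    using assms(2) unfolding cesaro_weakly_accumulating_def by blast
  then show "\<tau>\<^sub>m closure_of (convex hull ((\<lambda>t. T t x) ` {0..})) \<inter> fixed_space T \<noteq> {}"
    using weak_accumulation_point_fixed[OF assms(1)] weak_accumulation_point_in_closure by blast
qed

section \<open>The kernels of the generator and of its adjoint\<close>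

lemma limitin_generator:
  assumes "x \<in> generator_domain \<tau> T"
  shows "limitin \<tau> (\<lambda>t. (T t x - x) /\<^sub>R t) (generator \<tau> T x) (at_right 0)"
  using assms generator_eq by (auto simp: generator_domain_def)

lemma generator_domain_bound:
  assumes "x \<in> generator_domain \<tau> T"
  obtains M where "\<And>t. 0 < t \<Longrightarrow> t < 1 \<Longrightarrow> norm ((T t x - x) /\<^sub>R t) \<le> M"
proof -
  have "bdd_above ((\<lambda>t. norm ((T t x - x) /\<^sub>R t)) ` {0<..<1})"
    using assms by (simp add: generator_domain_def)
  then obtain M where M: "\<And>y. y \<in> (\<lambda>t. norm ((T t x - x) /\<^sub>R t)) ` {0<..<1} \<Longrightarrow> y \<le> M"
    unfolding bdd_above_def by blast
  show ?thesis by (rule that, rule M) (auto intro: imageI)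
qed

lemma fixed_space_subset_ker_generator: "fixed_space T \<subseteq> ker_generator \<tau> T"
proof
  fix x assume x: "x \<in> fixed_space T"
  then have 0: "(T t x - x) /\<^sub>R t = 0" if "0 < t" for t using that by (auto simp: fixed_space_def)
  have "limitin \<tau> (\<lambda>t. 0) 0 (at_right 0)" by simp
  then have lim: "limitin \<tau> (\<lambda>t. (T t x - x) /\<^sub>R t) 0 (at_right 0)"
    by (rule limitin_transform_eventually[rotated])
      (use 0 in \<open>auto intro!: eventually_at_rightI[of 0 1]\<close>)
  moreover have "bdd_above ((\<lambda>t. norm ((T t x - x) /\<^sub>R t)) ` {0<..<1})"
    using 0 by (intro bdd_aboveI[of _ 0]) auto
  ultimately show "x \<in> ker_generator \<tau> T"
    using generator_eq by (auto simp: ker_generator_def generator_domain_def)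
qed

text \<open>The quotients \<open>q n\<close> form a bounded \<tau>-null sequence, so bi-continuity
  makes \<open>T s (q n)\<close> small uniformly for \<open>s\<close> in \<open>{0..t}\<close>. The
  telescoping sum weights these terms by \<open>h n\<close>, with total weight
  \<open>t\<close>.\<close>

lemma ker_generator_subset_fixed_space: "ker_generator \<tau> T \<subseteq> fixed_space T"
proof
  fix x assume "x \<in> ker_generator \<tau> T"
  then have x: "x \<in> generator_domain \<tau> T" and "generator \<tau> T x = 0"
    by (auto simp: ker_generator_def)
  then have lim: "limitin \<tau> (\<lambda>t. (T t x - x) /\<^sub>R t) 0 (at_right 0)"
    using limitin_generator by metis
  obtain M where M: "\<And>t. 0 < t \<Longrightarrow> t < 1 \<Longrightarrow> norm ((T t x - x) /\<^sub>R t) \<le> M"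
    by (rule generator_domain_bound[OF x]) (rule that)
  have "T t x = x" if t: "0 < t" for t
  proof (rule eq_by_duality)
    fix \<phi> assume \<phi>: "\<phi> \<in> top_dual \<tau>"
    then have lin: "linear \<phi>" and cont: "continuous_map \<tau> euclideanreal \<phi>"
      by (auto simp: top_dual_def)
    \<comment> \<open>Starting beyond \<open>t\<close> gives \<open>h n < 1\<close>, so that the
      bound \<open>M\<close> from the generator domain applies, and keeps \<open>k n\<close>
      positive.\<close>
    obtain N where N: "t < real N" using reals_Archimedean2 by blast
    define k where "k n = n + N" for n
    define h where "h n = t / real (k n)" for n
    have k: "0 < k n" for n using N t by (cases N) (auto simp: k_def)
    have h: "0 < h n" "h n < 1" "real (k n) * h n = t" for n
      using t k[of n] N by (auto simp: h_def k_def field_simps)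
    have "h \<longlonglongrightarrow> 0"
    proof -
      have "(\<lambda>n. t / real n) \<longlonglongrightarrow> 0" by (rule lim_const_over_n)
      then show ?thesis unfolding h_def k_def by (rule LIMSEQ_ignore_initial_segment)
    qed
    then have "filterlim h (at_right 0) sequentially"
      using h(1) by (simp add: filterlim_at less_imp_neq[symmetric])
    define q where "q n = (T (h n) x - x) /\<^sub>R h n" for n
    have q: "limitin \<tau> q 0 sequentially" "\<And>n. norm (q n) \<le> M"
      unfolding q_def
      using limitin_compose_filterlim[OF lim \<open>filterlim h (at_right 0) sequentially\<close>] M[OF h(1,2)]
      by simp_all
    have telescope: "\<phi> (T t x) - \<phi> x = (\<Sum>j<k n. h n * \<phi> (T (real j * h n) (q n)))" for n
    proof -
      have "h n * \<phi> (T (real j * h n) (q n)) = \<phi> (T (real (Suc j) * h n) x) - \<phi> (T (real j * h n) x)" for j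
      proof -
        have "h n *\<^sub>R T (real j * h n) (q n) = T (real j * h n) (T (h n) x) - T (real j * h n) x"
          using h(1)[of n] by (simp add: q_def blinfun.scaleR_right[symmetric] blinfun.diff_right[symmetric])
        also have "T (real j * h n) (T (h n) x) = T (real j * h n + h n) x"
          using h(1)[of n] by (intro T_add[symmetric]) auto
        finally have "h n *\<^sub>R T (real j * h n) (q n) = T (real (Suc j) * h n) x - T (real j * h n) x"
          by (simp add: algebra_simps)
        from arg_cong[OF this, of \<phi>] show ?thesis
          unfolding linear_scale[OF lin] linear_diff[OF lin] by simp
      qed
      then have "(\<Sum>j<k n. h n * \<phi> (T (real j * h n) (q n)))
          = (\<Sum>j<k n. \<phi> (T (real (Suc j) * h n) x) - \<phi> (T (real j * h n) x))" by simp
      also have "\<dots> = \<phi> (T (real (k n) * h n) x) - \<phi> (T (real 0 * h n) x)"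
        by (rule sum_lessThan_telescope)
      finally show ?thesis by (simp add: h(3))
    qed
    have "\<bar>\<phi> (T t x) - \<phi> x\<bar> \<le> 0 + e" if e: "0 < e" for e
    proof -
      \<comment> \<open>The threshold \<open>e / t\<close> is chosen so that \<open>k n\<close>
        terms of size \<open>h n * (e / t)\<close> add up to \<open>e\<close>.\<close>
      have "openin \<tau> {z. \<phi> z \<in> ball 0 (e / t)}"
        using openin_continuous_map_preimage[OF cont, of "ball 0 (e / t)"] by simp
      moreover have "0 \<in> {z. \<phi> z \<in> ball 0 (e / t)}" using linear_0[OF lin] e t by simp
      \<comment> \<open>One index serves for all times in \<open>{0..t}\<close>. This local
        uniformity is essential, as the number of summands grows with \<open>n\<close>.\<close>
      ultimately obtain n where n: "\<And>s. s \<in> {0..t} \<Longrightarrow> T s (q n) - T s 0 \<in> {z. \<phi> z \<in> ball 0 (e / t)}"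
        using T_uniform[OF q(2,1), of _ t] by blast
      have "\<bar>\<phi> (T t x) - \<phi> x\<bar> \<le> (\<Sum>j<k n. h n * (e / t))"
        unfolding telescope[of n]
      proof (rule order_trans[OF sum_abs], rule sum_mono)
        fix j assume "j \<in> {..<k n}"
        then have "real j * h n \<le> real (k n) * h n" using h(1)[of n] by (intro mult_right_mono) auto
        then have "\<bar>\<phi> (T (real j * h n) (q n))\<bar> < e / t"
          using n[of "real j * h n"] h(1,3)[of n] by simp
        then show "\<bar>h n * \<phi> (T (real j * h n) (q n))\<bar> \<le> h n * (e / t)"
          using h(1)[of n] by (simp only: abs_mult abs_of_pos mult_left_mono less_imp_le)
      qed
      also have "\<dots> = (real (k n) * h n) * (e / t)" by simp
      also have "\<dots> = 0 + e" using h(3) t by simp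
      finally show ?thesis .
    qed
    then have "\<bar>\<phi> (T t x) - \<phi> x\<bar> \<le> 0" by (rule field_le_epsilon)
    then show "\<phi> (T t x) = \<phi> x" by simp
  qed
  then have "T t x = x" if "0 \<le> t" for t using that by (cases "t = 0") auto
  then show "x \<in> fixed_space T" by (simp add: fixed_space_def)
qed

text \<open>An invariant functional vanishes on the difference quotients; their boundedness, part of
  the definition of the domain, turns the \<tau>-limit into a \<open>\<tau>\<^sub>m\<close>-limit.
  Conversely \<open>T t x - x\<close> is the generator applied to \<open>J t x\<close>, so a
  functional vanishing on the range of the generator is invariant.\<close>

lemma dual_fixed_space_eq:
  "dual_fixed_space (top_dual \<tau>\<^sub>m) T = ker_dual_generator (top_dual \<tau>\<^sub>m) \<tau> T"
proof (intro equalityI subsetI)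
  fix \<phi> assume "\<phi> \<in> dual_fixed_space (top_dual \<tau>\<^sub>m) T"
  then have \<phi>: "\<phi> \<in> top_dual \<tau>\<^sub>m" and inv: "\<And>t z. 0 \<le> t \<Longrightarrow> \<phi> (T t z) = \<phi> z"
    by (auto simp: dual_fixed_space_def dual_map_def fun_eq_iff)
  have lin: "linear \<phi>" using \<phi> by (simp add: top_dual_def)
  have "\<phi> (generator \<tau> T x) = 0" if x: "x \<in> generator_domain \<tau> T" for x
  proof -
    obtain M where M: "\<And>t. 0 < t \<Longrightarrow> t < 1 \<Longrightarrow> norm ((T t x - x) /\<^sub>R t) \<le> M"
      by (rule generator_domain_bound[OF x]) (rule that)
    have "\<forall>\<^sub>F t in at_right 0. norm ((T t x - x) /\<^sub>R t) \<le> M"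
      using M by (intro eventually_at_rightI[of 0 1]) auto
    from tendsto_top_dual[OF \<phi> limitin_mixed[OF limitin_generator[OF x] this]]
    have lim: "((\<lambda>t. \<phi> ((T t x - x) /\<^sub>R t)) \<longlongrightarrow> \<phi> (generator \<tau> T x)) (at_right 0)" .
    have zero: "\<phi> ((T t x - x) /\<^sub>R t) = 0" if "0 < t" for t
      using inv[of t x] that by (simp only: linear_scale[OF lin] linear_diff[OF lin]) simp
    have "((\<lambda>t. \<phi> ((T t x - x) /\<^sub>R t)) \<longlongrightarrow> 0) (at_right 0)"
      by (rule tendsto_eventually) (use zero in \<open>auto intro!: eventually_at_rightI[of 0 1]\<close>)
    then show ?thesis using lim tendsto_unique trivial_limit_at_right_real by blast
  qed
  then show "\<phi> \<in> ker_dual_generator (top_dual \<tau>\<^sub>m) \<tau> T"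
    using \<phi> by (simp add: ker_dual_generator_def)
next
  fix \<phi> assume "\<phi> \<in> ker_dual_generator (top_dual \<tau>\<^sub>m) \<tau> T"
  then have \<phi>: "\<phi> \<in> top_dual \<tau>\<^sub>m" and ker: "\<And>x. x \<in> generator_domain \<tau> T \<Longrightarrow> \<phi> (generator \<tau> T x) = 0"
    by (auto simp: ker_dual_generator_def)
  have lin: "linear \<phi>" using \<phi> by (simp add: top_dual_def)
  have "\<phi> (T t x) = \<phi> x" if "0 \<le> t" for t x
    using ker[OF J_in_generator_domain(1)[OF that, of x]]
    unfolding J_in_generator_domain(2)[OF that] linear_diff[OF lin] by simp
  then show "\<phi> \<in> dual_fixed_space (top_dual \<tau>\<^sub>m) T"
    using \<phi> by (auto simp: dual_fixed_space_def dual_map_def)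
qed

end

theorem theorem3p12:
  fixes T :: "real \<Rightarrow> 'a::banach \<Rightarrow>\<^sub>L 'a" and \<tau> \<tau>\<^sub>m :: "'a topology"
  assumes "bicontinuous_setting \<tau>"
    and "is_mixed_topology \<tau> \<tau>\<^sub>m"
    and "bicontinuous_semigroup \<tau> T"
    and "contraction_semigroup T"
  shows "(mean_ergodic \<tau> T \<longrightarrow> cesaro_weakly_convergent \<tau> \<tau>\<^sub>m T) \<and>
         (cesaro_weakly_convergent \<tau> \<tau>\<^sub>m T \<longrightarrow> cesaro_weakly_accumulating \<tau> \<tau>\<^sub>m T) \<and>
         (metrizable_space \<tau> \<longrightarrow>
            cesaro_weakly_accumulating \<tau> \<tau>\<^sub>m T \<longrightarrow> orbit_hulls_meet_fixed_space \<tau>\<^sub>m T) \<and>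
         (orbit_hulls_meet_fixed_space \<tau>\<^sub>m T \<longrightarrow>
            separates (fixed_space T) (dual_fixed_space (top_dual \<tau>\<^sub>m) T)) \<and>
         fixed_space T = ker_generator \<tau> T \<and>
         dual_fixed_space (top_dual \<tau>\<^sub>m) T = ker_dual_generator (top_dual \<tau>\<^sub>m) \<tau> T"
proof -
  interpret bicontinuous_contraction \<tau> \<tau>\<^sub>m T
    using assms by unfold_locales (simp_all add: bicontinuous_setting_def)
  show ?thesis
    using mean_ergodic_imp_weakly_convergent weakly_convergent_imp_weakly_accumulating
      weakly_accumulating_imp_orbit_hulls orbit_hulls_imp_separates
      fixed_space_subset_ker_generator ker_generator_subset_fixed_space dual_fixed_space_eq
    by blast
qed

end
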